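(* Almost surely, $$1\le \liminf_{n\to\infty}\frac{\mathrm{Diam}_n}{\log n}\le \limsup_{n\to\infty}\frac{\mathrm{Diam}_n}{\log n}\le 4e .$$
   Context: The random friend tree process $(T_n)_{n\ge 2}$ is defined as follows. $T_2$ is a single edge joining vertices labelled $1$ and $2$. For $n\ge 2$, given $T_n$ (and the past of the process), $V_n$ is chosen uniformly at random in $\{1,\dots,n\}$, and then $W_n$ is a uniformly random neighbour of $V_n$ in $T_n$; $T_{n+1}$ is obtained from $T_n$ by adding a new vertex labelled $n+1$ joined by an edge to $W_n$. Thus $T_n$ is a tree with vertex set $[n]=\{1,\dots,n\}$. For $i,j\in[n]$, $d_n(i,j)$ is the graph distance between $i$ and $j$ in $T_n$, and $\mathrm{Diam}_n:=\max_{i,j\in[n]}d_n(i,j)$ is the diameter of $T_n$. Here $\log$ is the natural logarithm and $e$ its base. *)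

theory Defs
  imports "HOL-Probability.Probability"
begin

text \<open>A simple graph is given by its set of edges, each edge being the set of its two endpoints.\<close>

definition neighbours :: "'a set set \<Rightarrow> 'a \<Rightarrow> 'a set" where
  "neighbours E v = {u. {u, v} \<in> E}"

text \<open>The length of a shortest walk from \<open>i\<close> to \<open>j\<close>; the value is meaningful only for vertices
  in the same connected component.\<close>

definition graph_dist :: "'a set set \<Rightarrow> 'a \<Rightarrow> 'a \<Rightarrow> nat" where
  "graph_dist E i j = (LEAST k. (i, j) \<in> {(u, v). {u, v} \<in> E} ^^ k)"

definition graph_diameter :: "'a set \<Rightarrow> 'a set set \<Rightarrow> nat" where
  "graph_diameter U E = Max {graph_dist E i j | i j. i \<in> U \<and> j \<in> U}"

text \<open>\<open>attach_tree w n\<close> is the edge set of the tree on \<open>{1..n}\<close>, for \<open>n \<ge> 2\<close>, in which vertex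
  \<open>k + 1\<close> was attached to \<open>w k\<close> for \<open>2 \<le> k < n\<close>. It depends only on these values of \<open>w\<close>.
  The values for \<open>n < 2\<close> are arbitrary.\<close>

primrec attach_tree :: "(nat \<Rightarrow> nat) \<Rightarrow> nat \<Rightarrow> nat set set" where
  "attach_tree w 0 = {{1, 2}}"
| "attach_tree w (Suc n) =
     (if n < 2 then {{1, 2}} else insert {Suc n, w n} (attach_tree w n))"

text \<open>All variables are discrete, so conditioning on the past of the process before step \<open>n\<close>
  amounts to conditioning on each event of positive probability fixing the values of
  \<open>V k\<close> and \<open>W k\<close> for \<open>2 \<le> k < n\<close>. On such an event the current tree is \<open>attach_tree w n\<close>, and it
  is a tree on \<open>{1..n}\<close>, so the sets passed to \<open>pmf_of_set\<close> below are finite and nonempty.\<close>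

locale random_friend_tree = prob_space M for M :: "'a measure" +
  fixes V W :: "nat \<Rightarrow> 'a \<Rightarrow> nat"
  assumes measurable_V: "\<And>n. n \<ge> 2 \<Longrightarrow> V n \<in> measurable M (count_space UNIV)"
    and measurable_W: "\<And>n. n \<ge> 2 \<Longrightarrow> W n \<in> measurable M (count_space UNIV)"
    and uniform_vertex:
      "\<And>n v w a. n \<ge> 2 \<Longrightarrow>
         \<P>(\<omega> in M. \<forall>k\<in>{2..<n}. V k \<omega> = v k \<and> W k \<omega> = w k) > 0 \<Longrightarrow>
         \<P>(\<omega> in M. V n \<omega> = a \<bar> \<forall>k\<in>{2..<n}. V k \<omega> = v k \<and> W k \<omega> = w k)
           = pmf (pmf_of_set {1..n}) a"
    and uniform_neighbour:
      "\<And>n v w a b. n \<ge> 2 \<Longrightarrow>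
         \<P>(\<omega> in M. (\<forall>k\<in>{2..<n}. V k \<omega> = v k \<and> W k \<omega> = w k) \<and> V n \<omega> = a) > 0 \<Longrightarrow>
         \<P>(\<omega> in M. W n \<omega> = b \<bar> (\<forall>k\<in>{2..<n}. V k \<omega> = v k \<and> W k \<omega> = w k) \<and> V n \<omega> = a)
           = pmf (pmf_of_set (neighbours (attach_tree w n) a)) b"

definition friend_tree :: "(nat \<Rightarrow> 'a \<Rightarrow> nat) \<Rightarrow> nat \<Rightarrow> 'a \<Rightarrow> nat set set" where
  "friend_tree W n \<omega> = attach_tree (\<lambda>k. W k \<omega>) n"

definition Diam :: "(nat \<Rightarrow> 'a \<Rightarrow> nat) \<Rightarrow> nat \<Rightarrow> 'a \<Rightarrow> nat" where
  "Diam W n \<omega> = graph_diameter {1..n} (friend_tree W n \<omega>)"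

end

theory Submission
  imports Defs "HOL-Library.Discrete_Functions"
begin

text \<open>
Both bounds come from exponential moments of the diameter, which is nondecreasing in time because
a new vertex never shortens an old distance.

Upper bound. Forget the friends: joining \<open>n + 1\<close> to \<open>V\<^sub>n\<close> itself would give a uniform random
recursive tree. Since \<open>W\<^sub>n\<close> is a neighbour of \<open>V\<^sub>n\<close>, the true distance from vertex \<open>1\<close> to \<open>n + 1\<close>
exceeds that of \<open>V\<^sub>n\<close> by at most \<open>2\<close>, so it is at most twice the recursive depth plus one
(\<open>dist_root_le_recursive_depth\<close>), and the diameter is at most four times the height of the recursive
tree plus two. The expected sum of \<open>e\<close> to the power depth over all vertices is multiplied by \<open>1 + e / n\<close> at
step \<open>n\<close>, hence is of order \<open>n\<close> to the power \<open>e\<close> (\<open>expected_depth_sum_le\<close>). So the height is at most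
\<open>(e + o(1)) ln n\<close>, and this is where \<open>4 e\<close> comes from.

Lower bound. The diameter grows whenever \<open>W\<^sub>n\<close> is an endpoint of a longest path, and this has
conditional probability at least \<open>1 / n\<close> (\<open>extremal_mass\<close>). To see this, look at the neighbour \<open>p\<close> of
such an endpoint on a longest path: all neighbours of \<open>p\<close> except at most one are again endpoints of longest
paths, so if \<open>V\<^sub>n = p\<close>, then an endpoint is chosen with probability at least \<open>1 / 2\<close>. A longest path
has two ends, and the two vertices \<open>p\<close> they give either differ or coincide; in the latter case
the tree is a star with centre \<open>p\<close>, and every neighbour of \<open>p\<close> is an endpoint. Therefore the expectation of \<open>exp (- t Diam\<^sub>n)\<close> is
multiplied by at most \<open>1 - (1 - exp (- t)) / n\<close> at step \<open>n\<close>
(\<open>expected_exp_neg_diameter_le\<close>), and letting \<open>t\<close> tend to \<open>0\<close> gives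
\<open>Diam\<^sub>n \<ge> (1 - o(1)) ln n\<close>.

Both moment bounds turn into almost sure statements in the same way: Markov's inequality and the
Borel-Cantelli lemma along the powers of two, where the error probabilities form a geometric series
(\<open>dyadic_eventually_le\<close>), and monotonicity in between. The conditional uniformity assumptions enter
only through the law of the finite list of past choices, which is the Markov chain \<open>history_pmf\<close>
(\<open>distr_history\<close>).
\<close>

section \<open>Graph distance and pendant vertices\<close>

definition adj :: "'a set set \<Rightarrow> ('a \<times> 'a) set" where
  "adj E = {(u, v). {u, v} \<in> E}"

lemma in_adj [simp]: "(u, v) \<in> adj E \<longleftrightarrow> {u, v} \<in> E"
  by (simp add: adj_def)

lemma adj_mono: "E \<subseteq> E' \<Longrightarrow> adj E \<subseteq> adj E'"
  by (auto simp: adj_def)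

lemma adj_relpow_mono: "(i, j) \<in> adj E ^^ k \<Longrightarrow> E \<subseteq> E' \<Longrightarrow> (i, j) \<in> adj E' ^^ k"
proof (induction k arbitrary: j)
  case (Suc k)
  then obtain y where "(i, y) \<in> adj E ^^ k" "(y, j) \<in> adj E" by auto
  then show ?case using Suc by (auto intro!: relcompI[of i y])
qed auto

lemma graph_dist_adj: "graph_dist E i j = (LEAST k. (i, j) \<in> adj E ^^ k)"
  by (simp add: graph_dist_def adj_def)

lemma graph_dist_le:
  "(i, j) \<in> adj E ^^ k \<Longrightarrow> graph_dist E i j \<le> k"
  unfolding graph_dist_adj by (rule Least_le)

lemma graph_dist_walk:
  assumes "(i, j) \<in> (adj E)\<^sup>*"
  shows "(i, j) \<in> adj E ^^ graph_dist E i j"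
proof -
  obtain k where "(i, j) \<in> adj E ^^ k"
    using assms by (auto simp: rtrancl_power)
  then show ?thesis unfolding graph_dist_adj by (rule LeastI)
qed

lemma graph_dist_self [simp]: "graph_dist E i i = 0"
  using graph_dist_le[where k = 0 and i = i and j = i and E = E] by simp

lemma graph_dist_eq_0:
  assumes "(i, j) \<in> (adj E)\<^sup>*" "graph_dist E i j = 0"
  shows "i = j"
  using graph_dist_walk[OF assms(1)] assms(2) by simp

lemma adj_relpow_sym: "(i, j) \<in> adj E ^^ k \<Longrightarrow> (j, i) \<in> adj E ^^ k"
proof (induction k arbitrary: j)
  case (Suc k)
  then obtain y where y: "(i, y) \<in> adj E ^^ k" "(y, j) \<in> adj E" by auto
  have "(j, y) \<in> adj E" using y(2) by (simp add: insert_commute)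
  from relpow_Suc_I2[OF this Suc.IH[OF y(1)]] show ?case .
qed auto

lemma graph_dist_commute: "graph_dist E i j = graph_dist E j i"
proof -
  have "(i, j) \<in> adj E ^^ k \<longleftrightarrow> (j, i) \<in> adj E ^^ k" for k
    using adj_relpow_sym by metis
  then show ?thesis unfolding graph_dist_adj by simp
qed

lemma graph_dist_triangle:
  assumes "(i, j) \<in> (adj E)\<^sup>*" "(j, k) \<in> (adj E)\<^sup>*"
  shows "graph_dist E i k \<le> graph_dist E i j + graph_dist E j k"
  by (rule graph_dist_le)
     (use graph_dist_walk[OF assms(1)] graph_dist_walk[OF assms(2)] in
       \<open>auto simp: relpow_add\<close>)

lemma graph_dist_edge: "{i, j} \<in> E \<Longrightarrow> graph_dist E i j \<le> 1"
  by (rule graph_dist_le) auto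

text \<open>The second vertex of a shortest walk.\<close>

lemma closer_neighbour:
  assumes "(u, v) \<in> (adj E)\<^sup>*" "u \<noteq> v"
  obtains p where "p \<in> neighbours E u" "Suc (graph_dist E p v) = graph_dist E u v"
proof -
  have "graph_dist E u v \<noteq> 0" using graph_dist_eq_0[OF assms(1)] assms(2) by auto
  then obtain k where k: "graph_dist E u v = Suc k" by (cases "graph_dist E u v") auto
  have "(u, v) \<in> adj E ^^ Suc k" using graph_dist_walk[OF assms(1)] unfolding k .
  then obtain p where p: "(u, p) \<in> adj E" "(p, v) \<in> adj E ^^ k"
    by (rule relpow_Suc_E2)
  have "(p, v) \<in> (adj E)\<^sup>*" by (rule relpow_imp_rtrancl[OF p(2)])
  then have "(u, v) \<in> adj E ^^ Suc (graph_dist E p v)"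
    by (rule relpow_Suc_I2[OF p(1) graph_dist_walk])
  then have "Suc k \<le> Suc (graph_dist E p v)" using graph_dist_le k by metis
  moreover have "graph_dist E p v \<le> k" using graph_dist_le[OF p(2)] .
  moreover have "p \<in> neighbours E u" using p(1) by (simp add: neighbours_def insert_commute)
  ultimately show ?thesis using that k by simp
qed

text \<open>Replacing every visit to the pendant vertex \<open>x\<close> by a visit to its only neighbour \<open>w\<close> turns a walk in
  the enlarged graph into one in the old graph. The step across the new edge disappears, hence the
  strict inequality for walks that end in \<open>x\<close>.\<close>

lemma pendant_walk_retracts:
  assumes U: "\<Union>E \<subseteq> U" and x: "x \<notin> U" and w: "w \<in> U" and i: "i \<in> U"
    and walk: "(i, j) \<in> adj (insert {x, w} E) ^^ k"
  shows "\<exists>k'. (i, if j = x then w else j) \<in> adj E ^^ k' \<and> (if j = x then k' < k else k' \<le> k)"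
  using walk
proof (induction k arbitrary: j)
  case 0
  then show ?case using i x by (auto intro!: exI[of _ 0])
next
  case (Suc k)
  then obtain y where y: "(i, y) \<in> adj (insert {x, w} E) ^^ k"
    and yj: "{y, j} = {x, w} \<or> {y, j} \<in> E" by auto
  obtain k' where k': "(i, if y = x then w else y) \<in> adj E ^^ k'"
    "if y = x then k' < k else k' \<le> k"
    using Suc.IH[OF y] by blast
  have xw: "x \<noteq> w" using x w by auto
  show ?case
  proof (cases "{y, j} \<in> E")
    case True
    then have "y \<noteq> x" "j \<noteq> x" using U x by auto
    then have "(i, j) \<in> adj E ^^ Suc k'" "Suc k' \<le> Suc k"
      using k' True by auto
    then show ?thesis using \<open>j \<noteq> x\<close> by (intro exI[of _ "Suc k'"]) simp
  next
    case False
    then have "y = x \<and> j = w \<or> y = w \<and> j = x" using yj by (auto simp: doubleton_eq_iff)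
    then show ?thesis using k' xw by (intro exI[of _ k']) auto
  qed
qed

lemma pendant_dist_old:
  assumes U: "\<Union>E \<subseteq> U" "x \<notin> U" "w \<in> U" "i \<in> U" "j \<in> U" and ij: "(i, j) \<in> (adj E)\<^sup>*"
  shows "graph_dist (insert {x, w} E) i j = graph_dist E i j"
proof (rule antisym)
  have sub: "adj E \<subseteq> adj (insert {x, w} E)" by (rule adj_mono) auto
  then have "(adj E)\<^sup>* \<subseteq> (adj (insert {x, w} E))\<^sup>*" by (rule rtrancl_mono)
  then have "(i, j) \<in> (adj (insert {x, w} E))\<^sup>*" using ij by blast
  from pendant_walk_retracts[OF U(1-4) graph_dist_walk[OF this]]
  obtain k' where k': "(i, j) \<in> adj E ^^ k'" "k' \<le> graph_dist (insert {x, w} E) i j"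
    using U(2,5) by (auto split: if_splits)
  then show "graph_dist E i j \<le> graph_dist (insert {x, w} E) i j"
    using graph_dist_le[OF k'(1)] by linarith
  show "graph_dist (insert {x, w} E) i j \<le> graph_dist E i j"
    by (rule graph_dist_le) (rule adj_relpow_mono[OF graph_dist_walk[OF ij]], auto)
qed

lemma pendant_dist_new:
  assumes U: "\<Union>E \<subseteq> U" "x \<notin> U" "w \<in> U" "i \<in> U" and iw: "(i, w) \<in> (adj E)\<^sup>*"
  shows "graph_dist (insert {x, w} E) i x = Suc (graph_dist E i w)"
proof (rule antisym)
  have "(i, w) \<in> adj (insert {x, w} E) ^^ graph_dist E i w"
    by (rule adj_relpow_mono[OF graph_dist_walk[OF iw]]) auto
  moreover have "(w, x) \<in> adj (insert {x, w} E)" by (simp add: insert_commute)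
  ultimately have walk: "(i, x) \<in> adj (insert {x, w} E) ^^ Suc (graph_dist E i w)" by auto
  then show "graph_dist (insert {x, w} E) i x \<le> Suc (graph_dist E i w)"
    by (rule graph_dist_le)
  have "(i, x) \<in> (adj (insert {x, w} E))\<^sup>*" by (rule relpow_imp_rtrancl[OF walk])
  from pendant_walk_retracts[OF U(1-4) graph_dist_walk[OF this]]
  obtain k' where k': "(i, w) \<in> adj E ^^ k'" "k' < graph_dist (insert {x, w} E) i x"
    by auto
  then show "Suc (graph_dist E i w) \<le> graph_dist (insert {x, w} E) i x"
    using graph_dist_le[OF k'(1)] by linarith
qed

section \<open>Trees grown by attaching leaves\<close>

definition attachment :: "(nat \<Rightarrow> nat) \<Rightarrow> nat \<Rightarrow> bool" where
  "attachment w n \<longleftrightarrow> (\<forall>k\<in>{2..<n}. w k \<in> {1..k})"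

lemma attachment_Suc: "n \<ge> 2 \<Longrightarrow> attachment w (Suc n) \<longleftrightarrow> attachment w n \<and> w n \<in> {1..n}"
  by (auto simp: attachment_def less_Suc_eq)

lemma attach_tree_cong:
  "(\<And>k. k \<in> {2..<n} \<Longrightarrow> w k = w' k) \<Longrightarrow> attach_tree w n = attach_tree w' n"
  by (induction n) auto

lemma attach_tree_2 [simp]: "attach_tree w 2 = {{1, 2}}"
  by (simp add: numeral_2_eq_2)

lemma attach_tree_Suc: "n \<ge> 2 \<Longrightarrow> attach_tree w (Suc n) = insert {Suc n, w n} (attach_tree w n)"
  by simp

lemma attach_tree_vertices:
  assumes "n \<ge> 2" "attachment w n"
  shows "\<Union>(attach_tree w n) \<subseteq> {1..n}"
  using assms
proof (induction n rule: dec_induct)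
  case (step n)
  then show ?case unfolding attach_tree_Suc[OF step(1)] by (auto simp: attachment_Suc)
qed auto

lemma attach_tree_connected:
  assumes "n \<ge> 2" "attachment w n" "i \<in> {1..n}" "j \<in> {1..n}"
  shows "(i, j) \<in> (adj (attach_tree w n))\<^sup>*"
proof -
  have "(i, 1) \<in> (adj (attach_tree w n))\<^sup>* \<and> (1, i) \<in> (adj (attach_tree w n))\<^sup>*"
    if "i \<in> {1..n}" for i
    using assms(1,2) that
  proof (induction n arbitrary: i rule: dec_induct)
    case base
    then have "i = 1 \<or> i = 2" by auto
    then show ?case by (auto simp: insert_commute intro!: r_into_rtrancl)
  next
    case (step n)
    let ?E = "attach_tree w (Suc n)"
    have E: "?E = insert {Suc n, w n} (attach_tree w n)" using step by simp
    have "adj (attach_tree w n) \<subseteq> adj ?E" unfolding E by (rule adj_mono) auto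
    then have mono: "(adj (attach_tree w n))\<^sup>* \<subseteq> (adj ?E)\<^sup>*" by (rule rtrancl_mono)
    have old: "(k, 1) \<in> (adj ?E)\<^sup>*" "(1, k) \<in> (adj ?E)\<^sup>*" if "k \<in> {1..n}" for k
      using step.IH[of k] that step mono by (auto simp: attachment_Suc)
    show ?case
    proof (cases "i = Suc n")
      case True
      have "(i, w n) \<in> adj ?E" "(w n, i) \<in> adj ?E" unfolding E True by (auto simp: insert_commute)
      moreover have "w n \<in> {1..n}" using step by (simp add: attachment_Suc)
      ultimately show ?thesis using old[of "w n"]
        by (meson converse_rtrancl_into_rtrancl rtrancl.rtrancl_into_rtrancl)
    next
      case False
      then show ?thesis using old[of i] step by auto
    qed
  qed
  from rtrancl_trans[OF conjunct1[OF this[OF assms(3)]] conjunct2[OF this[OF assms(4)]]]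
  show ?thesis .
qed

lemma attach_tree_dist_old:
  assumes "n \<ge> 2" "attachment w (Suc n)" "i \<in> {1..n}" "j \<in> {1..n}"
  shows "graph_dist (attach_tree w (Suc n)) i j = graph_dist (attach_tree w n) i j"
  unfolding attach_tree_Suc[OF assms(1)]
  by (rule pendant_dist_old[OF attach_tree_vertices _ _ _ _ attach_tree_connected])
     (use assms in \<open>simp_all add: attachment_Suc\<close>)

lemma attach_tree_dist_new:
  assumes "n \<ge> 2" "attachment w (Suc n)" "i \<in> {1..n}"
  shows "graph_dist (attach_tree w (Suc n)) i (Suc n) = Suc (graph_dist (attach_tree w n) i (w n))"
  unfolding attach_tree_Suc[OF assms(1)]
  by (rule pendant_dist_new[OF attach_tree_vertices _ _ _ attach_tree_connected])
     (use assms in \<open>simp_all add: attachment_Suc\<close>)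

lemma neighbours_attach_tree_subset:
  assumes "n \<ge> 2" "attachment w n"
  shows "neighbours (attach_tree w n) v \<subseteq> {1..n}"
  using attach_tree_vertices[OF assms] by (auto simp: neighbours_def)

lemma neighbours_attach_tree_nonempty:
  assumes "n \<ge> 2" "attachment w n" "v \<in> {1..n}"
  shows "neighbours (attach_tree w n) v \<noteq> {}"
proof -
  define u where "u = (if v = 1 then 2 else 1 :: nat)"
  have u: "u \<in> {1..n}" "v \<noteq> u" using assms(1) by (auto simp: u_def)
  obtain p where "p \<in> neighbours (attach_tree w n) v"
    by (rule closer_neighbour[OF attach_tree_connected[OF assms u(1)] u(2)])
  then show ?thesis by auto
qed

lemma neighbours_Suc_old:
  assumes "n \<ge> 2" "p \<in> {1..n}"
  shows "neighbours (attach_tree w (Suc n)) p =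
    neighbours (attach_tree w n) p \<union> (if p = w n then {Suc n} else {})"
  unfolding attach_tree_Suc[OF assms(1)] neighbours_def
  using assms(2) by (auto simp: doubleton_eq_iff)

lemma attach_tree_no_loops:
  assumes "n \<ge> 2" "attachment w n"
  shows "{v} \<notin> attach_tree w n"
  using assms
proof (induction n rule: dec_induct)
  case (step n)
  then show ?case unfolding attach_tree_Suc[OF step(1)] by (auto simp: attachment_Suc)
qed auto

text \<open>The property of trees behind the lower bound: seen from \<open>v\<close>, every neighbour of \<open>p\<close> lies one
  step beyond \<open>p\<close>, except possibly the one on the path from \<open>p\<close> to \<open>v\<close>. Attaching a leaf preserves
  this, since the leaf copies the distances of its neighbour, increased by one.\<close>

lemma attach_tree_unique_approach:
  assumes "n \<ge> 2" "attachment w n" "v \<in> {1..n}" "p \<in> {1..n}"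
    and "z \<in> neighbours (attach_tree w n) p"
    and "graph_dist (attach_tree w n) z v \<noteq> Suc (graph_dist (attach_tree w n) p v)"
    and "z' \<in> neighbours (attach_tree w n) p"
    and "graph_dist (attach_tree w n) z' v \<noteq> Suc (graph_dist (attach_tree w n) p v)"
  shows "z = z'"
  using assms
proof (induction n arbitrary: v p z z' rule: dec_induct)
  case base
  then show ?case by (auto simp: neighbours_def doubleton_eq_iff)
next
  case (step n)
  let ?E = "attach_tree w n" and ?E' = "attach_tree w (Suc n)" and ?x = "Suc n"
  have n: "n \<ge> 2" and att: "attachment w (Suc n)" and att': "attachment w n" and w: "w n \<in> {1..n}"
    using step.hyps step.prems(1) by (auto simp: attachment_Suc)
  note old = attach_tree_dist_old[OF n att] and new = attach_tree_dist_new[OF n att]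
  have new': "graph_dist ?E' ?x i = Suc (graph_dist ?E i (w n))" if "i \<in> {1..n}" for i
    using new[OF that] by (subst graph_dist_commute)
  have sub: "neighbours ?E p \<subseteq> {1..n}" for p
    using neighbours_attach_tree_subset[OF n att'] .
  show ?case
  proof (cases "p = ?x")
    case True
    have "neighbours ?E' ?x \<subseteq> {w n}"
      unfolding attach_tree_Suc[OF n] neighbours_def
      using attach_tree_vertices[OF n att'] by (auto simp: doubleton_eq_iff)
    then have "z = w n" "z' = w n" using step.prems(4,6) unfolding True by blast+
    then show ?thesis by simp
  next
    case False
    then have p: "p \<in> {1..n}" using step.prems(3) by auto
    note nb = neighbours_Suc_old[OF n p]
    show ?thesis
    proof (cases "v = ?x")
      case v: False
      then have v: "v \<in> {1..n}" using step.prems(2) by auto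
      have exc: "y \<in> neighbours ?E p \<and> graph_dist ?E y v \<noteq> Suc (graph_dist ?E p v)"
        if "y \<in> neighbours ?E' p" "graph_dist ?E' y v \<noteq> Suc (graph_dist ?E' p v)" for y
      proof (cases "y = ?x")
        case True
        then have "p = w n" using that(1) sub[of p] unfolding nb by (auto split: if_splits)
        then have False
          using that(2) True new'[OF v] old[OF p v] graph_dist_commute[of ?E v p] by simp
        then show ?thesis ..
      next
        case False
        then have y: "y \<in> neighbours ?E p" using that(1) unfolding nb by (auto split: if_splits)
        then show ?thesis using that(2) old[OF _ v] p sub by (metis subsetD)
      qed
      note zz' = exc[OF step.prems(4,5)] exc[OF step.prems(6,7)]
      show ?thesis
        by (rule step.IH[OF att' v p conjunct1[OF zz'(1)] conjunct2[OF zz'(1)]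
              conjunct1[OF zz'(2)] conjunct2[OF zz'(2)]])
    next
      case v: True
      have far: "graph_dist ?E' y v = Suc (graph_dist ?E y (w n))" if "y \<in> {1..n}" for y
        using new[OF that] v by simp
      show ?thesis
      proof (cases "p = w n")
        case True
        \<comment> \<open>here the new leaf itself is the only neighbour closer to it\<close>
        have "y = ?x"
          if "y \<in> neighbours ?E' p" "graph_dist ?E' y v \<noteq> Suc (graph_dist ?E' p v)" for y
        proof (rule ccontr)
          assume "y \<noteq> ?x"
          then have y: "y \<in> neighbours ?E p" using that(1) unfolding nb by (auto split: if_splits)
          then have y': "y \<in> {1..n}" using sub by blast
          have "graph_dist ?E y p \<noteq> 1" using that(2) far[OF y'] far[OF p] True by simp
          moreover have "graph_dist ?E y p \<le> 1"
            using y by (intro graph_dist_edge) (simp add: neighbours_def)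
          ultimately have "graph_dist ?E y p = 0" by simp
          then have "y = p" using graph_dist_eq_0 attach_tree_connected[OF n att' y' p] by metis
          then show False using y attach_tree_no_loops[OF n att'] by (auto simp: neighbours_def)
        qed
        from this[OF step.prems(4,5)] this[OF step.prems(6,7)]
        show ?thesis by (rule trans[OF _ sym])
      next
        case False
        then have nb': "neighbours ?E' p = neighbours ?E p" using nb by simp
        have near: "graph_dist ?E y (w n) \<noteq> Suc (graph_dist ?E p (w n))"
          if "y \<in> neighbours ?E p" "graph_dist ?E' y v \<noteq> Suc (graph_dist ?E' p v)" for y
          using that far p sub by (metis subsetD)
        have zz': "z \<in> neighbours ?E p" "z' \<in> neighbours ?E p"
          using step.prems(4,6) nb' by metis+
        show ?thesis
          by (rule step.IH[OF att' w p zz'(1) near[OF zz'(1) step.prems(5)]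
                zz'(2) near[OF zz'(2) step.prems(7)]])
      qed
    qed
  qed
qed

section \<open>Diameter and endpoints of longest paths\<close>

lemma finite_graph_dists: "finite U \<Longrightarrow> finite {graph_dist E i j | i j. i \<in> U \<and> j \<in> U}"
  by (rule finite_subset[of _ "(\<lambda>(i, j). graph_dist E i j) ` (U \<times> U)"]) auto

lemma graph_dist_le_diameter:
  assumes "finite U" "i \<in> U" "j \<in> U"
  shows "graph_dist E i j \<le> graph_diameter U E"
  unfolding graph_diameter_def
  by (rule Max_ge[OF finite_graph_dists[OF assms(1)]]) (use assms in blast)

lemma graph_diameter_attained:
  assumes "finite U" "U \<noteq> {}"
  obtains i j where "i \<in> U" "j \<in> U" "graph_dist E i j = graph_diameter U E"
proof -
  have "graph_diameter U E \<in> {graph_dist E i j | i j. i \<in> U \<and> j \<in> U}"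
    unfolding graph_diameter_def
    by (rule Max_in[OF finite_graph_dists[OF assms(1)]]) (use assms in blast)
  then obtain i j where "i \<in> U" "j \<in> U" "graph_diameter U E = graph_dist E i j" by auto
  then show ?thesis by (intro that[of i j]) simp_all
qed

abbreviation tree_diameter :: "(nat \<Rightarrow> nat) \<Rightarrow> nat \<Rightarrow> nat" where
  "tree_diameter w n \<equiv> graph_diameter {1..n} (attach_tree w n)"

definition extremal :: "(nat \<Rightarrow> nat) \<Rightarrow> nat \<Rightarrow> nat set" where
  "extremal w n = {z \<in> {1..n}. \<exists>y\<in>{1..n}. graph_dist (attach_tree w n) z y = tree_diameter w n}"

lemma tree_diameter_mono:
  assumes "n \<ge> 2" "attachment w (Suc n)"
  shows "tree_diameter w n \<le> tree_diameter w (Suc n)"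
proof -
  obtain i j where ij: "i \<in> {1..n}" "j \<in> {1..n}"
    "graph_dist (attach_tree w n) i j = tree_diameter w n"
    using assms(1) by (auto intro: graph_diameter_attained[of "{1..n}" "attach_tree w n"])
  have "tree_diameter w n = graph_dist (attach_tree w (Suc n)) i j"
    using attach_tree_dist_old[OF assms ij(1,2)] ij(3) by metis
  also have "\<dots> \<le> tree_diameter w (Suc n)"
    by (rule graph_dist_le_diameter) (use ij in auto)
  finally show ?thesis .
qed

lemma tree_diameter_grows:
  assumes "n \<ge> 2" "attachment w (Suc n)" "w n \<in> extremal w n"
  shows "Suc (tree_diameter w n) \<le> tree_diameter w (Suc n)"
proof -
  obtain y where y: "y \<in> {1..n}" "graph_dist (attach_tree w n) (w n) y = tree_diameter w n"
    using assms(3) by (auto simp: extremal_def)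
  have "graph_dist (attach_tree w (Suc n)) y (Suc n) = Suc (tree_diameter w n)"
    using attach_tree_dist_new[OF assms(1,2) y(1)] y(2) graph_dist_commute by metis
  moreover have "graph_dist (attach_tree w (Suc n)) y (Suc n) \<le> tree_diameter w (Suc n)"
    by (rule graph_dist_le_diameter) (use y in auto)
  ultimately show ?thesis by simp
qed

context
  fixes w :: "nat \<Rightarrow> nat" and n :: nat
  assumes n: "n \<ge> 2" and att: "attachment w n"
begin

private abbreviation (input) "E \<equiv> attach_tree w n"
private abbreviation (input) "d \<equiv> graph_dist E"
private abbreviation (input) "N \<equiv> neighbours E"
private abbreviation (input) "X \<equiv> extremal w n"

private lemma N_finite: "finite (N p)"
  using neighbours_attach_tree_subset[OF n att] finite_subset by blast

text \<open>A neighbour \<open>z\<close> of \<open>p\<close> with distance one more than \<open>p\<close> from \<open>v\<close> is at distance \<open>d u v\<close> from \<open>v\<close>, so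
  the neighbours of \<open>p\<close> that are not extremal are exceptional in the sense of
  \<open>attach_tree_unique_approach\<close>, and there is at most one of them. As \<open>u\<close> itself is extremal, at least
  half of the neighbours are.\<close>

private lemma half_extremal:
  assumes u: "u \<in> {1..n}" and v: "v \<in> {1..n}" and D: "d u v = tree_diameter w n"
    and p: "p \<in> N u" "Suc (d p v) = d u v"
  shows "card (N p) \<le> 2 * card (N p \<inter> X)" "u \<in> N p"
    and "\<And>z. z \<in> N p \<Longrightarrow> z \<notin> X \<Longrightarrow> d z v \<noteq> Suc (d p v)"
proof -
  show uN: "u \<in> N p" using p(1) by (simp add: neighbours_def insert_commute)
  have pn: "p \<in> {1..n}" using p(1) neighbours_attach_tree_subset[OF n att] by blast
  show exc: "d z v \<noteq> Suc (d p v)" if "z \<in> N p" "z \<notin> X" for z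
  proof
    assume "d z v = Suc (d p v)"
    then have "d z v = tree_diameter w n" using p(2) D by simp
    moreover have "z \<in> {1..n}" using that(1) neighbours_attach_tree_subset[OF n att] by blast
    ultimately show False using that(2) v by (auto simp: extremal_def)
  qed
  have "card (N p - X) \<le> 1"
  proof (rule ccontr)
    assume "\<not> card (N p - X) \<le> 1"
    then have "\<not> (\<forall>z\<in>N p - X. \<forall>z'\<in>N p - X. z = z')"
      using card_le_Suc0_iff_eq[of "N p - X"] N_finite by simp
    then obtain z z' where z: "z \<in> N p" "z \<notin> X" "z' \<in> N p" "z' \<notin> X" "z \<noteq> z'" by blast
    show False
      using attach_tree_unique_approach[OF n att v pn z(1) exc[OF z(1,2)] z(3) exc[OF z(3,4)]] z(5)
      by simp
  qed
  moreover have "card (N p) = card (N p \<inter> X) + card (N p - X)"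
    using N_finite by (metis card_Int_Diff)
  moreover have "u \<in> N p \<inter> X" using uN u v D by (auto simp: extremal_def)
  then have "card (N p \<inter> X) \<noteq> 0" using N_finite by auto
  ultimately show "card (N p) \<le> 2 * card (N p \<inter> X)" by linarith
qed

text \<open>Divided by \<open>n\<close>, the sum is the conditional probability that the next vertex is attached to an
  endpoint of a longest path. The neighbours \<open>p\<close> and \<open>q\<close> of the two ends of one longest path already
  contribute \<open>1\<close>.\<close>

lemma extremal_mass:
  "(\<Sum>a = 1..n. real (card (N a \<inter> X)) / card (N a)) \<ge> 1"
proof -
  define D where "D = tree_diameter w n"
  obtain u v where uv: "u \<in> {1..n}" "v \<in> {1..n}" "d u v = tree_diameter w n"
    using n by (auto intro: graph_diameter_attained[of "{1..n}" E])
  have vu: "d v u = tree_diameter w n" using uv(3) by (subst graph_dist_commute)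
  have "u \<noteq> v"
  proof
    assume "u = v"
    then have "tree_diameter w n = 0" using uv(3) by simp
    moreover have "d 1 2 \<le> tree_diameter w n" by (rule graph_dist_le_diameter) (use n in auto)
    ultimately have "d 1 2 = 0" by simp
    moreover have "(1, 2) \<in> (adj E)\<^sup>*" by (rule attach_tree_connected[OF n att]) (use n in auto)
    ultimately have "(1::nat) = 2" using graph_dist_eq_0 by metis
    then show False by simp
  qed
  obtain p where p: "p \<in> N u" "Suc (d p v) = d u v"
    by (rule closer_neighbour[OF attach_tree_connected[OF n att uv(1,2)] \<open>u \<noteq> v\<close>])
  obtain q where q: "q \<in> N v" "Suc (d q u) = d v u"
    by (rule closer_neighbour[OF attach_tree_connected[OF n att uv(2,1)] \<open>u \<noteq> v\<close>[symmetric]])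
  note hp = half_extremal[OF uv p] and hq = half_extremal[OF uv(2,1) vu q]
  have pq: "p \<in> {1..n}" "q \<in> {1..n}"
    using p(1) q(1) neighbours_attach_tree_subset[OF n att] by blast+
  have pos: "card (N p) > 0" "card (N q) > 0"
    using hp(2) hq(2) N_finite by (auto simp: card_gt_0_iff)
  let ?f = "\<lambda>a. real (card (N a \<inter> X)) / card (N a)"
  have "1 \<le> (\<Sum>a\<in>{p, q}. ?f a)"
  proof (cases "p = q")
    case False
    have "?f p \<ge> 1 / 2" "?f q \<ge> 1 / 2"
      using hp(1) hq(1) pos by (simp_all add: field_simps)
    then have "1 \<le> ?f p + ?f q" by linarith
    then show ?thesis using False by simp
  next
    case True
    \<comment> \<open>the diameter is \<open>2\<close>, so the only neighbour of \<open>p\<close> not at full distance from \<open>v\<close> is \<open>v\<close>\<close>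
    have vN: "v \<in> N p" using hq(2) True by simp
    have vX: "v \<in> X" using uv vu by (auto simp: extremal_def)
    have pv: "d v v \<noteq> Suc (d p v)" by simp
    have "N p \<subseteq> X"
    proof
      fix z assume z: "z \<in> N p"
      show "z \<in> X"
      proof (rule ccontr)
        assume "z \<notin> X"
        from attach_tree_unique_approach[OF n att uv(2) pq(1) z hp(3)[OF z this] vN pv] vX this
        show False by simp
      qed
    qed
    then have "N p \<inter> X = N p" by blast
    then show ?thesis using True pos by simp
  qed
  also have "\<dots> \<le> (\<Sum>a = 1..n. ?f a)"
    by (rule sum_mono2) (use pq in auto)
  finally show ?thesis .
qed

end

section \<open>Comparison with recursive trees\<close>

text \<open>Depth in the recursive tree in which \<open>i\<close> hangs below the chosen vertex \<open>v (i - 1)\<close> itself instead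
  of below one of its neighbours. Vertices \<open>1\<close> and \<open>2\<close> are both roots. The test \<open>v (i - 1) < i\<close> makes
  the recursion terminate for arbitrary \<open>v\<close>.\<close>

fun recursive_depth :: "(nat \<Rightarrow> nat) \<Rightarrow> nat \<Rightarrow> nat" where
  "recursive_depth v i = (if 3 \<le> i \<and> v (i - 1) < i then Suc (recursive_depth v (v (i - 1))) else 0)"

declare recursive_depth.simps [simp del]

lemma recursive_depth_new:
  "n \<ge> 2 \<Longrightarrow> v n \<in> {1..n} \<Longrightarrow> recursive_depth v (Suc n) = Suc (recursive_depth v (v n))"
  by (subst recursive_depth.simps) auto

lemma recursive_depth_cong:
  assumes "\<And>k. k \<in> {2..<i} \<Longrightarrow> v k = v' k"
  shows "recursive_depth v i = recursive_depth v' i"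
  using assms
proof (induction i rule: less_induct)
  case (less i)
  show ?case
  proof (cases "3 \<le> i")
    case True
    then have "v (i - 1) = v' (i - 1)" by (intro less.prems) auto
    then show ?thesis using less
      by (subst (1 2) recursive_depth.simps) auto
  qed (subst (1 2) recursive_depth.simps, simp)
qed

definition friend_choices :: "(nat \<Rightarrow> nat) \<Rightarrow> (nat \<Rightarrow> nat) \<Rightarrow> nat \<Rightarrow> bool" where
  "friend_choices v w n \<longleftrightarrow>
     (\<forall>k\<in>{2..<n}. v k \<in> {1..k} \<and> w k \<in> neighbours (attach_tree w k) (v k))"

lemma friend_choices_attachment:
  assumes "friend_choices v w n"
  shows "attachment w n"
proof (cases "n \<ge> 2")
  case True
  then show ?thesis using assms
  proof (induction n rule: dec_induct)
    case (step n)
    have prev: "attachment w n" using step by (auto simp: friend_choices_def)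
    have "w n \<in> neighbours (attach_tree w n) (v n)"
      using step.hyps step.prems by (auto simp: friend_choices_def)
    then have "w n \<in> {1..n}"
      using neighbours_attach_tree_subset[OF step.hyps(1) prev] by (rule subsetD[rotated])
    then show ?case using prev by (simp add: attachment_Suc[OF step.hyps(1)])
  qed (simp add: attachment_def)
qed (simp add: attachment_def)

lemma friend_choices_Suc:
  "n \<ge> 2 \<Longrightarrow> friend_choices v w (Suc n) \<longleftrightarrow>
     friend_choices v w n \<and> v n \<in> {1..n} \<and> w n \<in> neighbours (attach_tree w n) (v n)"
  by (auto simp: friend_choices_def less_Suc_eq)

text \<open>Going from the chosen vertex to its friend and then to the new vertex costs at most two edges, while
  the recursive depth increases by one. The additional \<open>1\<close> is the distance between the roots
  \<open>1\<close> and \<open>2\<close>.\<close>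

lemma dist_root_le_recursive_depth:
  assumes "n \<ge> 2" "friend_choices v w n" "i \<in> {1..n}"
  shows "graph_dist (attach_tree w n) 1 i \<le> 2 * recursive_depth v i + 1"
  using assms
proof (induction n arbitrary: i rule: dec_induct)
  case base
  then have "i = 1 \<or> i = 2" by auto
  then show ?case using graph_dist_edge[of 1 2 "{{1, 2::nat}}"] by auto
next
  case (step n)
  note n = step.hyps(1)
  have fc: "friend_choices v w n" "v n \<in> {1..n}" "w n \<in> neighbours (attach_tree w n) (v n)"
    using step.prems(1) friend_choices_Suc[OF n] by auto
  note att = friend_choices_attachment[OF step.prems(1)] and att' = friend_choices_attachment[OF fc(1)]
  have one: "1 \<in> {1..n}" using n by simp
  have w: "w n \<in> {1..n}" using fc(3) neighbours_attach_tree_subset[OF n att'] by blast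
  show ?case
  proof (cases "i = Suc n")
    case False
    then have "i \<in> {1..n}" using step.prems(2) by auto
    with step.IH[OF fc(1) this] show ?thesis
      using attach_tree_dist_old[OF n att one] by simp
  next
    case True
    have "graph_dist (attach_tree w (Suc n)) 1 i = Suc (graph_dist (attach_tree w n) 1 (w n))"
      using attach_tree_dist_new[OF n att one] True by simp
    also have "graph_dist (attach_tree w n) 1 (w n)
        \<le> graph_dist (attach_tree w n) 1 (v n) + graph_dist (attach_tree w n) (v n) (w n)"
      by (rule graph_dist_triangle[OF attach_tree_connected[OF n att' one fc(2)]
            attach_tree_connected[OF n att' fc(2) w]])
    also have "graph_dist (attach_tree w n) (v n) (w n) \<le> 1"
      by (rule graph_dist_edge) (use fc(3) in \<open>simp add: neighbours_def insert_commute\<close>)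
    also have "graph_dist (attach_tree w n) 1 (v n) \<le> 2 * recursive_depth v (v n) + 1"
      by (rule step.IH[OF fc(1,2)])
    finally show ?thesis using recursive_depth_new[of n v, OF n fc(2)] True by simp
  qed
qed

text \<open>A longest path has length at most twice the largest distance from vertex \<open>1\<close>, that is, at most
  \<open>4 h + 2\<close> for the largest recursive depth \<open>h\<close>; a maximum of exponentials is bounded by their sum.\<close>

lemma tree_diameter_le_depth_sum:
  assumes "n \<ge> 2" "friend_choices v w n"
  shows "exp (real (tree_diameter w n) / 4)
    \<le> exp (1 / 2) * (\<Sum>i = 1..n. exp (real (recursive_depth v i)))"
proof -
  have att: "attachment w n" by (rule friend_choices_attachment[OF assms(2)])
  let ?E = "attach_tree w n"
  obtain i j where ij: "i \<in> {1..n}" "j \<in> {1..n}" "graph_dist ?E i j = tree_diameter w n"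
    using assms(1) by (auto intro: graph_diameter_attained[of "{1..n}" ?E])
  have one: "1 \<in> {1..n}" using assms(1) by simp
  have "\<exists>k\<in>{1..n}. recursive_depth v i \<le> recursive_depth v k \<and> recursive_depth v j \<le> recursive_depth v k"
    using ij(1,2) linear by blast
  then obtain k where k: "k \<in> {1..n}"
    "recursive_depth v i \<le> recursive_depth v k" "recursive_depth v j \<le> recursive_depth v k" by blast
  have "tree_diameter w n \<le> graph_dist ?E i 1 + graph_dist ?E 1 j"
    using graph_dist_triangle[OF attach_tree_connected[OF assms(1) att ij(1) one]
        attach_tree_connected[OF assms(1) att one ij(2)]] ij(3) by simp
  also have "graph_dist ?E i 1 = graph_dist ?E 1 i" by (rule graph_dist_commute)
  finally have "tree_diameter w n \<le> 4 * recursive_depth v k + 2"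
    using dist_root_le_recursive_depth[OF assms ij(1)]
      dist_root_le_recursive_depth[OF assms ij(2)] k by linarith
  then have "exp (real (tree_diameter w n) / 4) \<le> exp (1 / 2 + real (recursive_depth v k))"
    by (subst exp_le_cancel_iff) linarith
  also have "\<dots> = exp (1 / 2) * exp (real (recursive_depth v k))" by (rule exp_add)
  also have "exp (real (recursive_depth v k)) \<le> (\<Sum>i = 1..n. exp (real (recursive_depth v i)))"
    by (rule member_le_sum) (use k in auto)
  finally show ?thesis by simp
qed

section \<open>The chain of histories\<close>

text \<open>The chain rule for the joint law of two discrete variables, stored through an injective pairing such
  as appending to a list.\<close>

lemma pmf_bind_map_inj:
  assumes inj: "\<And>x y x' y'. g x y = g x' y' \<Longrightarrow> x = x' \<and> y = y'"
  shows "pmf (bind_pmf p (\<lambda>x. map_pmf (g x) (K x))) (g x y) = pmf p x * pmf (K x) y"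
proof -
  have eq: "pmf (map_pmf (g x') (K x')) (g x y) = indicator {x} x' * pmf (K x) y" for x'
  proof (cases "x' = x")
    case True
    have "inj (g x)" using inj by (auto intro: injI)
    then show ?thesis using True by (simp add: pmf_map_inj')
  next
    case False
    then have "g x y \<notin> set_pmf (map_pmf (g x') (K x'))" using inj by auto
    then have "pmf (map_pmf (g x') (K x')) (g x y) = 0" by (simp only: set_pmf_iff not_not)
    then show ?thesis using False by simp
  qed
  show ?thesis by (simp add: pmf_bind eq measure_pmf_single)
qed

text \<open>A history before step \<open>n\<close> lists the pairs of chosen vertex and friend at the steps \<open>2, \<dots>, n - 1\<close>, so
  that step \<open>k\<close> sits at position \<open>k - 2\<close>.\<close>

definition past_vertex :: "(nat \<times> nat) list \<Rightarrow> nat \<Rightarrow> nat" where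
  "past_vertex h k = fst (h ! (k - 2))"

definition past_friend :: "(nat \<times> nat) list \<Rightarrow> nat \<Rightarrow> nat" where
  "past_friend h k = snd (h ! (k - 2))"

lemma past_append:
  assumes "length h = n - 2" "k \<in> {2..<n}"
  shows "past_vertex (h @ [x]) k = past_vertex h k" "past_friend (h @ [x]) k = past_friend h k"
  using assms by (auto simp: past_vertex_def past_friend_def nth_append)

lemma past_last:
  assumes "length h = n - 2"
  shows "past_vertex (h @ [x]) n = fst x" "past_friend (h @ [x]) n = snd x"
  using assms by (auto simp: past_vertex_def past_friend_def nth_append)

definition friend_step :: "nat \<Rightarrow> (nat \<times> nat) list \<Rightarrow> (nat \<times> nat) pmf" where
  "friend_step n h = bind_pmf (pmf_of_set {1..n})
     (\<lambda>a. map_pmf (Pair a) (pmf_of_set (neighbours (attach_tree (past_friend h) n) a)))"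

primrec history_pmf :: "nat \<Rightarrow> (nat \<times> nat) list pmf" where
  "history_pmf 0 = return_pmf []"
| "history_pmf (Suc n) = (if n < 2 then return_pmf []
     else bind_pmf (history_pmf n) (\<lambda>h. map_pmf (\<lambda>x. h @ [x]) (friend_step n h)))"

lemma pmf_friend_step:
  "pmf (friend_step n h) (a, b) =
     pmf (pmf_of_set {1..n}) a * pmf (pmf_of_set (neighbours (attach_tree (past_friend h) n) a)) b"
  unfolding friend_step_def by (rule pmf_bind_map_inj) simp

lemma pmf_history_Suc:
  assumes "n \<ge> 2"
  shows "pmf (history_pmf (Suc n)) (h @ [x]) = pmf (history_pmf n) h * pmf (friend_step n h) x"
proof -
  have "history_pmf (Suc n) = bind_pmf (history_pmf n) (\<lambda>h. map_pmf (\<lambda>x. h @ [x]) (friend_step n h))"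
    using assms by simp
  then show ?thesis
    using pmf_bind_map_inj[of "\<lambda>h x. h @ [x]" "history_pmf n" "friend_step n" h x] by simp
qed

lemma friend_choices_cong:
  assumes "\<And>k. k \<in> {2..<n} \<Longrightarrow> v k = v' k" "\<And>k. k \<in> {2..<n} \<Longrightarrow> w k = w' k"
  shows "friend_choices v w n \<longleftrightarrow> friend_choices v' w' n"
proof -
  have "attach_tree w k = attach_tree w' k" if "k \<in> {2..<n}" for k
    by (rule attach_tree_cong) (use assms(2) that in auto)
  then show ?thesis using assms by (simp add: friend_choices_def)
qed

lemma friend_step_support:
  assumes "n \<ge> 2" "attachment (past_friend h) n" "x \<in> set_pmf (friend_step n h)"
  shows "fst x \<in> {1..n}" "snd x \<in> neighbours (attach_tree (past_friend h) n) (fst x)"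
proof -
  have ne: "{1..n} \<noteq> {}" using assms(1) by auto
  then have *: "fst x \<in> {1..n} \<and>
      snd x \<in> set_pmf (pmf_of_set (neighbours (attach_tree (past_friend h) n) (fst x)))"
    using assms(3) by (auto simp: friend_step_def set_pmf_of_set)
  then show "fst x \<in> {1..n}" ..
  have "finite (neighbours (attach_tree (past_friend h) n) (fst x))"
    using neighbours_attach_tree_subset[OF assms(1,2)] finite_subset by blast
  from set_pmf_of_set[OF neighbours_attach_tree_nonempty[OF assms(1,2) conjunct1[OF *]] this]
  show "snd x \<in> neighbours (attach_tree (past_friend h) n) (fst x)"
    using * by blast
qed

lemma friend_choices_append:
  assumes n: "n \<ge> 2" and len: "length h = n - 2"
    and h: "friend_choices (past_vertex h) (past_friend h) n"
    and x: "x \<in> set_pmf (friend_step n h)"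
  shows "friend_choices (past_vertex (h @ [x])) (past_friend (h @ [x])) (Suc n)"
proof -
  note past = past_append[OF len] past_last[OF len]
  have "friend_choices (past_vertex (h @ [x])) (past_friend (h @ [x])) n"
    using h friend_choices_cong[of n "past_vertex (h @ [x])" "past_vertex h"
        "past_friend (h @ [x])" "past_friend h"] past by blast
  moreover have "attach_tree (past_friend (h @ [x])) n = attach_tree (past_friend h) n"
    by (rule attach_tree_cong) (rule past)
  ultimately show ?thesis
    using friend_step_support[OF n friend_choices_attachment[OF h] x]
    by (simp add: friend_choices_Suc[OF n] past)
qed

lemma history_support:
  assumes "h \<in> set_pmf (history_pmf n)"
  shows "length h = n - 2 \<and> friend_choices (past_vertex h) (past_friend h) n"
  using assms
proof (induction n arbitrary: h)
  case 0
  then show ?case by (simp add: friend_choices_def)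
next
  case (Suc n)
  show ?case
  proof (cases "n < 2")
    case True
    then show ?thesis using Suc.prems by (auto simp: friend_choices_def)
  next
    case False
    then obtain h' x where h: "h' \<in> set_pmf (history_pmf n)" "x \<in> set_pmf (friend_step n h')"
      "h = h' @ [x]" using Suc.prems by auto
    then show ?thesis
      using Suc.IH[OF h(1)] friend_choices_append[of n h' x] False by auto
  qed
qed

lemma nn_integral_pmf_of_set_real:
  assumes "finite A" "A \<noteq> {}" "\<And>a. f a \<ge> 0"
  shows "(\<integral>\<^sup>+a. ennreal (f a) \<partial>pmf_of_set A) = ennreal (sum f A / card A)"
proof -
  have "integrable (pmf_of_set A) f"
    by (rule integrable_measure_pmf_finite) (use assms in simp)
  then show ?thesis
    using assms by (simp add: nn_integral_eq_integral integral_pmf_of_set)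
qed

lemma nn_integral_friend_step_vertex:
  assumes "n \<ge> 2" "\<And>a. f a \<ge> 0"
  shows "(\<integral>\<^sup>+x. ennreal (f (fst x)) \<partial>friend_step n h) = ennreal ((\<Sum>a = 1..n. f a) / n)"
proof -
  have "(\<integral>\<^sup>+x. ennreal (f (fst x)) \<partial>friend_step n h) = (\<integral>\<^sup>+a. ennreal (f a) \<partial>pmf_of_set {1..n})"
    by (simp add: friend_step_def measure_pmf.emeasure_space_1[simplified])
  also have "\<dots> = ennreal ((\<Sum>a = 1..n. f a) / n)"
    using nn_integral_pmf_of_set_real[of "{1..n}" f] assms by simp
  finally show ?thesis .
qed

lemma nn_integral_friend_step_friend:
  assumes n: "n \<ge> 2" and att: "attachment (past_friend h) n" and f: "\<And>b. f b \<ge> 0"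
  defines "N \<equiv> neighbours (attach_tree (past_friend h) n)"
  shows "(\<integral>\<^sup>+x. ennreal (f (snd x)) \<partial>friend_step n h) =
    ennreal ((\<Sum>a = 1..n. sum f (N a) / card (N a)) / n)"
proof -
  have fin: "finite (N a)" for a
    unfolding N_def using neighbours_attach_tree_subset[OF n att] finite_subset by blast
  have ne: "N a \<noteq> {}" if "a \<in> {1..n}" for a
    unfolding N_def by (rule neighbours_attach_tree_nonempty[OF n att that])
  have "(\<integral>\<^sup>+x. ennreal (f (snd x)) \<partial>friend_step n h)
      = (\<integral>\<^sup>+a. \<integral>\<^sup>+b. ennreal (f b) \<partial>pmf_of_set (N a) \<partial>pmf_of_set {1..n})"
    by (simp add: friend_step_def N_def)
  also have "\<dots> = (\<integral>\<^sup>+a. ennreal (sum f (N a) / card (N a)) \<partial>pmf_of_set {1..n})"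
  proof (rule nn_integral_cong_AE)
    have "{1..n} \<noteq> {}" using n by auto
    then show "AE a in pmf_of_set {1..n}. (\<integral>\<^sup>+b. ennreal (f b) \<partial>pmf_of_set (N a))
        = ennreal (sum f (N a) / card (N a))"
      by (auto simp: AE_measure_pmf_iff set_pmf_of_set
          intro!: nn_integral_pmf_of_set_real fin ne f)
  qed
  also have "\<dots> = ennreal ((\<Sum>a = 1..n. sum f (N a) / card (N a)) / n)"
    using nn_integral_pmf_of_set_real[of "{1..n}" "\<lambda>a. sum f (N a) / card (N a)"] n f
    by (simp add: sum_nonneg)
  finally show ?thesis .
qed

lemma nn_integral_history_Suc:
  assumes "n \<ge> 2"
  shows "(\<integral>\<^sup>+h. F h \<partial>history_pmf (Suc n)) =
    (\<integral>\<^sup>+h. (\<integral>\<^sup>+x. F (h @ [x]) \<partial>friend_step n h) \<partial>history_pmf n)"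
  using assms by simp

section \<open>Exponential moments\<close>

text \<open>The vertex born at step \<open>n\<close> contributes \<open>e\<close> times the average of the present terms, so that the
  expectation gets multiplied by \<open>1 + e / n\<close>. The base \<open>n - 1\<close> of the power makes the induction close,
  because \<open>1 / n \<le> ln (n / (n - 1))\<close>.\<close>

lemma expected_depth_sum_le:
  assumes "n \<ge> 2"
  shows "(\<integral>\<^sup>+h. ennreal (\<Sum>i = 1..n. exp (real (recursive_depth (past_vertex h) i))) \<partial>history_pmf n)
    \<le> ennreal (2 * (real n - 1) powr exp 1)"
  using assms
proof (induction n rule: dec_induct)
  case base
  have "recursive_depth v i = 0" if "i \<in> {1..2}" for v i
    using that by (subst recursive_depth.simps) auto
  then show ?case by (simp add: numeral_2_eq_2 measure_pmf.emeasure_space_1[simplified])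
next
  case (step n)
  note n = step.hyps(1)
  let ?S = "\<lambda>n h. \<Sum>i = 1..n. exp (real (recursive_depth (past_vertex h) i))"
  have inner: "(\<integral>\<^sup>+x. ennreal (?S (Suc n) (h @ [x])) \<partial>friend_step n h)
      = ennreal (?S n h) * ennreal (1 + exp 1 / real n)" if h: "h \<in> set_pmf (history_pmf n)" for h
  proof -
    have len: "length h = n - 2" and fc: "friend_choices (past_vertex h) (past_friend h) n"
      using history_support[OF h] by auto
    let ?e = "\<lambda>a. exp (real (recursive_depth (past_vertex h) a))"
    have eq: "?S (Suc n) (h @ [x]) = ?S n h + exp 1 * ?e (fst x)"
      if x: "x \<in> set_pmf (friend_step n h)" for x
    proof -
      have "fst x \<in> {1..n}"
        by (rule friend_step_support[OF n friend_choices_attachment[OF fc] x])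
      moreover have old: "recursive_depth (past_vertex (h @ [x])) i = recursive_depth (past_vertex h) i"
        if "i \<le> n" for i
        by (rule recursive_depth_cong, rule past_append(1)[OF len]) (use that in auto)
      ultimately have "recursive_depth (past_vertex (h @ [x])) (Suc n)
          = Suc (recursive_depth (past_vertex h) (fst x))"
        using recursive_depth_new[OF n, of "past_vertex (h @ [x])"] past_last(1)[OF len, of x] by simp
      then show ?thesis using old by (simp add: exp_add)
    qed
    have "(\<integral>\<^sup>+x. ennreal (?S (Suc n) (h @ [x])) \<partial>friend_step n h)
        = (\<integral>\<^sup>+x. ennreal (?S n h + exp 1 * ?e (fst x)) \<partial>friend_step n h)"
      by (rule nn_integral_cong_AE) (use eq in \<open>simp add: AE_measure_pmf_iff\<close>)
    also have "\<dots> = ennreal ((\<Sum>a = 1..n. ?S n h + exp 1 * ?e a) / n)"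
      by (rule nn_integral_friend_step_vertex[OF n]) (simp add: sum_nonneg)
    also have "(\<Sum>a = 1..n. ?S n h + exp 1 * ?e a) = real n * ?S n h + exp 1 * ?S n h"
      by (simp add: sum.distrib sum_distrib_left)
    also have "(real n * ?S n h + exp 1 * ?S n h) / real n = ?S n h * (1 + exp 1 / real n)"
      using n by (simp add: field_simps)
    finally show ?thesis by (simp add: ennreal_mult sum_nonneg)
  qed
  have "(\<integral>\<^sup>+h. ennreal (?S (Suc n) h) \<partial>history_pmf (Suc n))
      = (\<integral>\<^sup>+h. ennreal (?S n h) * ennreal (1 + exp 1 / real n) \<partial>history_pmf n)"
    unfolding nn_integral_history_Suc[OF n]
    by (rule nn_integral_cong_AE) (use inner in \<open>simp add: AE_measure_pmf_iff\<close>)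
  also have "\<dots> = (\<integral>\<^sup>+h. ennreal (?S n h) \<partial>history_pmf n) * ennreal (1 + exp 1 / real n)"
    by (rule nn_integral_multc) simp
  also have "\<dots> \<le> ennreal (2 * (real n - 1) powr exp 1) * ennreal (1 + exp 1 / real n)"
    by (rule mult_right_mono[OF step.IH]) simp
  also have "\<dots> = ennreal (2 * (real n - 1) powr exp 1 * (1 + exp 1 / real n))"
    by (simp add: ennreal_mult)
  also have "\<dots> \<le> ennreal (2 * (real (Suc n) - 1) powr exp 1)"
  proof (rule ennreal_leI)
    have "ln ((real n - 1) / n) \<le> (real n - 1) / n - 1"
      by (rule ln_le_minus_one) (use n in simp)
    then have "ln (real n - 1) + 1 / n \<le> ln n"
      using n by (simp add: ln_div field_simps)
    then have ln_le: "exp 1 * (ln (real n - 1) + 1 / n) \<le> exp 1 * ln n"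
      by (intro mult_left_mono) auto
    have "(real n - 1) powr exp 1 * (1 + exp 1 / real n)
        \<le> (real n - 1) powr exp 1 * exp (exp 1 / real n)"
      by (intro mult_left_mono exp_ge_add_one_self) auto
    also have "\<dots> = exp (exp 1 * (ln (real n - 1) + 1 / n))"
      using n by (simp add: powr_def exp_add[symmetric] algebra_simps)
    also have "\<dots> \<le> exp (exp 1 * ln n)" using ln_le by (subst exp_le_cancel_iff)
    also have "\<dots> = real n powr exp 1" using n by (simp add: powr_def)
    finally show "2 * (real n - 1) powr exp 1 * (1 + exp 1 / real n)
        \<le> 2 * (real (Suc n) - 1) powr exp 1" by simp
  qed
  finally show ?case .
qed

text \<open>Given the past, the diameter grows with probability at least \<open>1 / n\<close>, and then the exponential loses
  the factor \<open>exp (- t)\<close>. The estimate is the one for a sum of independent indicators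
  with means \<open>1 / k\<close>. The factor \<open>2\<close> starts the induction: at \<open>n = 2\<close> the power is at least
  \<open>1 / 2\<close>.\<close>

lemma expected_exp_neg_diameter_le:
  fixes t :: real
  assumes "n \<ge> 2" and t: "t > 0"
  shows "(\<integral>\<^sup>+h. ennreal (exp (- t * tree_diameter (past_friend h) n)) \<partial>history_pmf n)
    \<le> ennreal (2 * real n powr (exp (- t) - 1))"
  using assms(1)
proof (induction n rule: dec_induct)
  case base
  have "exp (- t * tree_diameter (past_friend h) 2) \<le> 1" for h
    using t by simp
  then have "(\<integral>\<^sup>+h. ennreal (exp (- t * tree_diameter (past_friend h) 2)) \<partial>history_pmf 2)
      \<le> (\<integral>\<^sup>+h. 1 \<partial>history_pmf 2)"
    by (intro nn_integral_mono) simp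
  also have "\<dots> = ennreal (2 * 2 powr (- 1))"
    by (simp add: measure_pmf.emeasure_space_1[simplified] powr_minus)
  also have "\<dots> \<le> ennreal (2 * 2 powr (exp (- t) - 1))"
    by (intro ennreal_leI mult_left_mono powr_mono) auto
  finally show ?case by simp
next
  case (step n)
  note n = step.hyps(1)
  define s where "s = 1 - exp (- t)"
  have s: "0 < s" "s < 1" using t by (auto simp: s_def)
  let ?D = "\<lambda>n h. tree_diameter (past_friend h) n"
  have inner: "(\<integral>\<^sup>+x. ennreal (exp (- t * ?D (Suc n) (h @ [x]))) \<partial>friend_step n h)
      \<le> ennreal (exp (- t * ?D n h)) * ennreal (1 - s / real n)" if h: "h \<in> set_pmf (history_pmf n)" for h
  proof -
    have len: "length h = n - 2" and fc: "friend_choices (past_vertex h) (past_friend h) n"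
      using history_support[OF h] by auto
    note att = friend_choices_attachment[OF fc]
    let ?X = "extremal (past_friend h) n" and ?N = "neighbours (attach_tree (past_friend h) n)"
    define f where "f = (\<lambda>b. exp (- t * ?D n h) * (1 - s * indicator ?X b))"
    have f0: "f b \<ge> 0" for b using s by (simp add: f_def indicator_def)
    have le: "exp (- t * ?D (Suc n) (h @ [x])) \<le> f (snd x)"
      if x: "x \<in> set_pmf (friend_step n h)" for x
    proof -
      have fc': "attachment (past_friend (h @ [x])) (Suc n)"
        by (rule friend_choices_attachment[OF friend_choices_append[OF n len fc x]])
      have tr: "attach_tree (past_friend (h @ [x])) n = attach_tree (past_friend h) n"
        by (rule attach_tree_cong) (rule past_append(2)[OF len])
      have ex: "extremal (past_friend (h @ [x])) n = ?X" by (simp add: extremal_def tr)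
      show ?thesis
      proof (cases "snd x \<in> ?X")
        case True
        have "Suc (?D n h) \<le> ?D (Suc n) (h @ [x])"
          using tree_diameter_grows[OF n fc'] True past_last(2)[OF len, of x] by (simp only: ex tr)
        then have "real (?D n h) + 1 \<le> real (?D (Suc n) (h @ [x]))" by linarith
        then have "t * (real (?D n h) + 1) \<le> t * real (?D (Suc n) (h @ [x]))"
          using t by (intro mult_left_mono) auto
        then have "exp (- t * ?D (Suc n) (h @ [x])) \<le> exp (- t * ?D n h + - t)"
          by (simp add: algebra_simps del: attach_tree.simps)
        also have "\<dots> = f (snd x)" unfolding exp_add using True by (simp add: f_def s_def)
        finally show ?thesis .
      next
        case False
        have "?D n h \<le> ?D (Suc n) (h @ [x])"
          using tree_diameter_mono[OF n fc'] by (simp only: tr)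
        then have "exp (- t * ?D (Suc n) (h @ [x])) \<le> exp (- t * ?D n h)"
          using t by (simp del: attach_tree.simps)
        then show ?thesis using False by (simp add: f_def del: attach_tree.simps)
      qed
    qed
    define g where "g a = real (card (?N a \<inter> ?X)) / card (?N a)" for a
    have avg: "sum f (?N a) / card (?N a)
        = exp (- t * ?D n h) * (1 - s * (card (?N a \<inter> ?X) / card (?N a)))"
      if a: "a \<in> {1..n}" for a
    proof -
      have fin: "finite (?N a)"
        using neighbours_attach_tree_subset[OF n att] finite_subset by blast
      then have "card (?N a) > 0"
        using neighbours_attach_tree_nonempty[OF n att a] by (simp add: card_gt_0_iff)
      moreover have "sum (indicat_real ?X) (?N a) = card (?N a \<inter> ?X)"
        using fin by (simp add: indicator_def sum.If_cases)
      then have "sum f (?N a) = exp (- t * ?D n h) * (card (?N a) - s * card (?N a \<inter> ?X))"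
        by (simp add: f_def sum_distrib_left[symmetric] sum_subtractf)
      ultimately show ?thesis by (simp add: field_simps)
    qed
    have "(\<integral>\<^sup>+x. ennreal (exp (- t * ?D (Suc n) (h @ [x]))) \<partial>friend_step n h)
        \<le> (\<integral>\<^sup>+x. ennreal (f (snd x)) \<partial>friend_step n h)"
      by (rule nn_integral_mono_AE)
         (use le in \<open>simp add: AE_measure_pmf_iff ennreal_leI del: attach_tree.simps\<close>)
    also have "\<dots> = ennreal ((\<Sum>a = 1..n. sum f (?N a) / card (?N a)) / n)"
      by (rule nn_integral_friend_step_friend[OF n att f0])
    also have "(\<Sum>a = 1..n. sum f (?N a) / card (?N a))
        = (\<Sum>a = 1..n. exp (- t * ?D n h) * (1 - s * g a))"
      by (rule sum.cong) (auto simp: avg g_def)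
    also have "\<dots> = exp (- t * ?D n h) * (n - s * (\<Sum>a = 1..n. g a))"
      by (simp add: sum_distrib_left[symmetric] sum_subtractf)
    also have "ennreal (\<dots> / n) \<le> ennreal (exp (- t * ?D n h) * (n - s * 1) / n)"
      using extremal_mass[OF n att, folded g_def] s
      by (intro ennreal_leI divide_right_mono mult_left_mono diff_left_mono) auto
    also have "exp (- t * ?D n h) * (n - s * 1) / n = exp (- t * ?D n h) * (1 - s / n)"
      using n by (simp add: field_simps)
    finally show ?thesis using s n by (simp add: ennreal_mult)
  qed
  have "(\<integral>\<^sup>+h. ennreal (exp (- t * ?D (Suc n) h)) \<partial>history_pmf (Suc n))
      \<le> (\<integral>\<^sup>+h. ennreal (exp (- t * ?D n h)) * ennreal (1 - s / real n) \<partial>history_pmf n)"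
    unfolding nn_integral_history_Suc[OF n]
    by (rule nn_integral_mono_AE) (use inner in \<open>simp add: AE_measure_pmf_iff del: attach_tree.simps\<close>)
  also have "\<dots> = (\<integral>\<^sup>+h. ennreal (exp (- t * ?D n h)) \<partial>history_pmf n) * ennreal (1 - s / real n)"
    by (rule nn_integral_multc) simp
  also have "\<dots> \<le> ennreal (2 * real n powr (- s)) * ennreal (1 - s / real n)"
    using step.IH by (intro mult_right_mono) (simp_all add: s_def)
  also have "\<dots> = ennreal (2 * real n powr (- s) * (1 - s / n))"
    using s n by (simp add: ennreal_mult)
  also have "\<dots> \<le> ennreal (2 * real (Suc n) powr (- s))"
  proof (rule ennreal_leI)
    have "1 - s / n \<le> exp (- (s / n))" using exp_ge_add_one_self[of "- (s / n)"] by simp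
    also have "\<dots> \<le> exp (- s * ln (1 + 1 / n))"
    proof -
      have "s * ln (1 + 1 / real n) \<le> s * (1 / n)"
        by (rule mult_left_mono[OF ln_add_one_self_le_self]) (use s in auto)
      then show ?thesis by simp
    qed
    also have "\<dots> = (1 + 1 / n) powr (- s)"
    proof -
      have "1 + 1 / real n > 0" by (simp add: add_pos_nonneg)
      then show ?thesis by (simp add: powr_def)
    qed
    finally have "real n powr (- s) * (1 - s / n) \<le> real n powr (- s) * (1 + 1 / n) powr (- s)"
      by (intro mult_left_mono) auto
    also have "\<dots> = (real n * (1 + 1 / n)) powr (- s)"
      by (rule powr_mult[symmetric])
    also have "real n * (1 + 1 / n) = real (Suc n)" using n by (simp add: field_simps)
    finally show "2 * real n powr (- s) * (1 - s / n) \<le> 2 * real (Suc n) powr (- s)" by simp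
  qed
  finally show ?case by (simp add: s_def)
qed

section \<open>From moments to almost sure growth along powers of two\<close>

text \<open>Markov's inequality bounds the probability of failure at time \<open>2 ^ k\<close> by \<open>C * (2 powr (a - b)) ^ k\<close>.
  The corresponding bounds at all times are not summable when \<open>b\<close> is close to \<open>a\<close>; along the powers
  of two they always are, and this suffices for monotone sequences.\<close>

lemma (in prob_space) dyadic_eventually_le:
  fixes Y :: "nat \<Rightarrow> 'a \<Rightarrow> real"
  assumes meas [measurable]: "\<And>n. n \<ge> 2 \<Longrightarrow> Y n \<in> borel_measurable M"
    and bound: "\<And>n. n \<ge> 2 \<Longrightarrow> (\<integral>\<^sup>+\<omega>. ennreal (Y n \<omega>) \<partial>M) \<le> ennreal (C * real n powr a)"
    and C: "C \<ge> 0" and ab: "a < b"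
  shows "AE \<omega> in M. \<forall>\<^sub>F k in sequentially. Y (2 ^ k) \<omega> \<le> (2 ^ k) powr b"
proof -
  define A where "A k = {\<omega> \<in> space M. (2 ^ Suc k) powr b < Y (2 ^ Suc k) \<omega>}" for k
  have two: "(2::nat) \<le> 2 ^ Suc k" for k by simp
  have A [measurable]: "A k \<in> sets M" for k
    using meas[OF two, of k] unfolding A_def by measurable
  have prob_A: "prob (A k) \<le> C * (2 powr (a - b)) ^ Suc k" for k
  proof -
    define N where "N = (2::real) ^ Suc k"
    have N: "N > 0" by (simp add: N_def)
    have "emeasure M (A k) \<le> emeasure M {\<omega> \<in> space M. 1 \<le> ennreal (N powr (- b)) * ennreal (Y (2 ^ Suc k) \<omega>)}"
    proof (rule emeasure_mono)
      show "A k \<subseteq> {\<omega> \<in> space M. 1 \<le> ennreal (N powr (- b)) * ennreal (Y (2 ^ Suc k) \<omega>)}"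
      proof
        fix \<omega> assume \<omega>: "\<omega> \<in> A k"
        then have "N powr b \<le> Y (2 ^ Suc k) \<omega>" by (simp add: A_def N_def)
        then have "N powr (- b) * N powr b \<le> N powr (- b) * Y (2 ^ Suc k) \<omega>"
          by (rule mult_left_mono) simp
        then have "1 \<le> N powr (- b) * Y (2 ^ Suc k) \<omega>"
          using N by (simp add: powr_add[symmetric])
        then have "1 \<le> ennreal (N powr (- b) * Y (2 ^ Suc k) \<omega>)" by simp
        then show "\<omega> \<in> {\<omega> \<in> space M. 1 \<le> ennreal (N powr (- b)) * ennreal (Y (2 ^ Suc k) \<omega>)}"
          using \<omega> by (simp add: A_def ennreal_mult')
      qed
    qed (use meas[OF two, of k] in measurable)
    also have "\<dots> \<le> ennreal (N powr (- b)) * (\<integral>\<^sup>+\<omega>. ennreal (Y (2 ^ Suc k) \<omega>) * indicator (space M) \<omega> \<partial>M)"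
      by (rule nn_integral_Markov_inequality) (use meas[OF two, of k] in measurable)
    also have "(\<integral>\<^sup>+\<omega>. ennreal (Y (2 ^ Suc k) \<omega>) * indicator (space M) \<omega> \<partial>M)
        = (\<integral>\<^sup>+\<omega>. ennreal (Y (2 ^ Suc k) \<omega>) \<partial>M)"
      by (rule nn_integral_cong) simp
    also have "ennreal (N powr (- b)) * (\<integral>\<^sup>+\<omega>. ennreal (Y (2 ^ Suc k) \<omega>) \<partial>M)
        \<le> ennreal (N powr (- b)) * ennreal (C * N powr a)"
      using bound[OF two, of k] by (intro mult_left_mono) (simp_all add: N_def)
    also have "ennreal (N powr (- b)) * ennreal (C * N powr a) = ennreal (C * N powr (a - b))"
      using C by (simp add: ennreal_mult'[symmetric] powr_diff powr_minus field_simps)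
    also have "N powr (a - b) = (2 powr (a - b)) ^ Suc k"
      by (simp add: N_def powr_realpow[symmetric] powr_powr mult.commute del: power_Suc)
    finally show ?thesis
      using C by (simp add: emeasure_eq_measure del: power_Suc)
  qed
  have "2 powr (a - b) < (1::real)" using ab by (simp add: powr_less_one)
  then have "summable (\<lambda>k. C * (2 powr (a - b)) ^ Suc k)"
    by (intro summable_mult summable_Suc_iff[THEN iffD2] summable_geometric) simp
  then have "summable (\<lambda>k. prob (A k))"
    by (rule summable_comparison_test_ev[rotated]) (use prob_A in \<open>simp del: power_Suc\<close>)
  then have "AE \<omega> in M. \<forall>\<^sub>F k in sequentially. \<omega> \<in> space M - A k"
    by (intro borel_cantelli_AE1) (auto simp: emeasure_eq_measure)
  then show ?thesis
  proof eventually_elim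
    case (elim \<omega>)
    then have "\<forall>\<^sub>F k in sequentially. Y (2 ^ Suc k) \<omega> \<le> (2 ^ Suc k) powr b"
      by eventually_elim (auto simp: A_def)
    then show ?case by (subst eventually_sequentially_Suc[symmetric])
  qed
qed

lemma dyadic_floor_log:
  assumes "n > (0::nat)"
  shows "2 ^ floor_log n \<le> n" "n < 2 ^ Suc (floor_log n)"
    "real (floor_log n) * ln 2 \<le> ln n" "ln n \<le> real (Suc (floor_log n)) * ln 2"
proof -
  define k where "k = floor_log n"
  have k: "2 ^ k \<le> n" "n < 2 ^ Suc k"
    using assms floor_log_exp2_le[of n] floor_log_exp2_gt[of n] by (simp_all add: k_def)
  have "real (2 ^ k) \<le> real n" "real n \<le> real (2 ^ Suc k)"
    using k by (simp_all only: of_nat_le_iff less_imp_le)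
  then have "(2::real) ^ k \<le> real n" "real n \<le> 2 ^ Suc k"
    by (simp_all only: of_nat_power of_nat_numeral)
  then have "ln ((2::real) ^ k) \<le> ln (real n)" "ln (real n) \<le> ln ((2::real) ^ Suc k)"
    using assms by (simp_all del: power_Suc)
  with k show "2 ^ floor_log n \<le> n" "n < 2 ^ Suc (floor_log n)"
    "real (floor_log n) * ln 2 \<le> ln n" "ln n \<le> real (Suc (floor_log n)) * ln 2"
    by (simp_all add: ln_realpow k_def del: power_Suc of_nat_Suc)
qed

lemma filterlim_floor_log: "filterlim floor_log at_top sequentially"
  unfolding filterlim_at_top_ge[of floor_log _ 0]
proof (intro allI impI)
  fix k :: nat
  show "\<forall>\<^sub>F n in sequentially. k \<le> floor_log n"
    using eventually_ge_at_top[of "2 ^ k :: nat"]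
  proof eventually_elim
    case (elim n)
    then have "floor_log (2 ^ k) \<le> floor_log n" by (rule floor_log_mono[THEN monoD])
    then show ?case by simp
  qed
qed

text \<open>Between consecutive powers of two the logarithm moves by \<open>ln 2\<close> only, which is negligible against
  \<open>ln n\<close>; so the growth constant of a monotone sequence can be read off along powers of two.\<close>

lemma limsup_dyadic_le:
  fixes X :: "nat \<Rightarrow> nat"
  assumes mono: "\<And>m n. 2 \<le> m \<Longrightarrow> m \<le> n \<Longrightarrow> X m \<le> X n"
    and bound: "\<forall>\<^sub>F k in sequentially. real (X (2 ^ k)) \<le> c * (real k * ln 2)" and c: "c \<ge> 0"
  shows "limsup (\<lambda>n. ereal (real (X n) / ln (real n))) \<le> ereal c"
proof -
  have "\<forall>\<^sub>F k in sequentially. real (X (2 ^ Suc k)) \<le> c * (real (Suc k) * ln 2)"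
    using bound by (subst eventually_sequentially_Suc)
  then have "\<forall>\<^sub>F n in sequentially. real (X (2 ^ Suc (floor_log n))) \<le> c * (real (Suc (floor_log n)) * ln 2)"
    by (rule eventually_compose_filterlim[OF _ filterlim_floor_log])
  then have "\<forall>\<^sub>F n in sequentially. ereal (real (X n) / ln (real n)) \<le> ereal (c + c * ln 2 / ln (real n))"
    using eventually_ge_at_top[of 2]
  proof eventually_elim
    case (elim n)
    have k: "n < 2 ^ Suc (floor_log n)" "real (floor_log n) * ln 2 \<le> ln n"
      using dyadic_floor_log[of n] elim by auto
    have "real (X n) \<le> real (X (2 ^ Suc (floor_log n)))"
      using mono[of n "2 ^ Suc (floor_log n)"] k(1) elim by (simp del: power_Suc)
    also have "\<dots> \<le> c * (real (floor_log n) * ln 2 + ln 2)"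
      using elim by (simp add: algebra_simps del: power_Suc)
    also have "\<dots> \<le> c * (ln n + ln 2)"
      by (intro mult_left_mono add_right_mono k c)
    finally have "real (X n) / ln n \<le> c * (ln n + ln 2) / ln n"
      using elim by (intro divide_right_mono) auto
    also have "\<dots> = c + c * ln 2 / ln n"
      using elim by (simp add: distrib_left add_divide_distrib)
    finally show ?case by simp
  qed
  then have "limsup (\<lambda>n. ereal (real (X n) / ln (real n)))
      \<le> limsup (\<lambda>n. ereal (c + c * ln 2 / ln (real n)))"
    by (rule Limsup_mono)
  also have "\<dots> = ereal c"
  proof (rule lim_imp_Limsup)
    have "(\<lambda>n. c + c * ln 2 / ln (real n)) \<longlonglongrightarrow> c + 0"
      by (intro tendsto_add tendsto_const tendsto_divide_0[OF tendsto_const]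
          filterlim_at_top_imp_at_infinity filterlim_compose[OF ln_at_top filterlim_real_sequentially])
    then show "(\<lambda>n. ereal (c + c * ln 2 / ln (real n))) \<longlonglongrightarrow> ereal c" by simp
  qed simp
  finally show ?thesis .
qed

lemma liminf_dyadic_ge:
  fixes X :: "nat \<Rightarrow> nat"
  assumes mono: "\<And>m n. 2 \<le> m \<Longrightarrow> m \<le> n \<Longrightarrow> X m \<le> X n"
    and bound: "\<forall>\<^sub>F k in sequentially. c * (real k * ln 2) \<le> real (X (2 ^ k))" and c: "c \<ge> 0"
  shows "ereal c \<le> liminf (\<lambda>n. ereal (real (X n) / ln (real n)))"
proof -
  have "\<forall>\<^sub>F n in sequentially. c * (real (floor_log n) * ln 2) \<le> real (X (2 ^ floor_log n))"
    by (rule eventually_compose_filterlim[OF bound filterlim_floor_log])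
  then have "\<forall>\<^sub>F n in sequentially. ereal (c - c * ln 2 / ln (real n)) \<le> ereal (real (X n) / ln (real n))"
    using eventually_ge_at_top[of 2]
  proof eventually_elim
    case (elim n)
    have k: "2 ^ floor_log n \<le> n" "ln n \<le> real (floor_log n) * ln 2 + ln 2"
      using dyadic_floor_log[of n] elim by (auto simp: algebra_simps)
    have "floor_log n \<ge> 1" using floor_log_rec[of n] elim by simp
    then have "(2::nat) ^ 1 \<le> 2 ^ floor_log n" by (intro power_increasing) auto
    then have "X (2 ^ floor_log n) \<le> X n" by (intro mono k) simp
    moreover have "c * (ln n - ln 2) \<le> c * (real (floor_log n) * ln 2)"
      using k(2) by (intro mult_left_mono c) simp
    ultimately have "c * (ln n - ln 2) / ln n \<le> real (X n) / ln n"
      using elim by (intro divide_right_mono) auto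
    moreover have "c * (ln n - ln 2) / ln n = c - c * ln 2 / ln n"
      using elim by (simp add: right_diff_distrib diff_divide_distrib)
    ultimately show ?case by simp
  qed
  then have "liminf (\<lambda>n. ereal (c - c * ln 2 / ln (real n)))
      \<le> liminf (\<lambda>n. ereal (real (X n) / ln (real n)))"
    by (rule Liminf_mono)
  moreover have "liminf (\<lambda>n. ereal (c - c * ln 2 / ln (real n))) = ereal c"
  proof (rule lim_imp_Liminf)
    have "(\<lambda>n. c - c * ln 2 / ln (real n)) \<longlonglongrightarrow> c - 0"
      by (intro tendsto_diff tendsto_const tendsto_divide_0[OF tendsto_const]
          filterlim_at_top_imp_at_infinity filterlim_compose[OF ln_at_top filterlim_real_sequentially])
    then show "(\<lambda>n. ereal (c - c * ln 2 / ln (real n))) \<longlonglongrightarrow> ereal c" by simp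
  qed simp
  ultimately show ?thesis by simp
qed

section \<open>Diameter of the random friend tree\<close>

context random_friend_tree
begin

definition history :: "nat \<Rightarrow> 'a \<Rightarrow> (nat \<times> nat) list" where
  "history n \<omega> = map (\<lambda>k. (V k \<omega>, W k \<omega>)) [2..<n]"

lemma length_history [simp]: "length (history n \<omega>) = n - 2"
  by (simp add: history_def)

lemma history_Suc: "n \<ge> 2 \<Longrightarrow> history (Suc n) \<omega> = history n \<omega> @ [(V n \<omega>, W n \<omega>)]"
  by (simp add: history_def)

lemma past_history:
  assumes "k \<in> {2..<n}"
  shows "past_vertex (history n \<omega>) k = V k \<omega>" "past_friend (history n \<omega>) k = W k \<omega>"
proof -
  have "history n \<omega> ! (k - 2) = (V k \<omega>, W k \<omega>)"
  proof -
    obtain i where "k = i + 2" using assms by (metis atLeastLessThan_iff add.commute le_Suc_ex)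
    moreover from this have "i < n - 2" using assms by simp
    ultimately show ?thesis by (simp add: history_def add.commute)
  qed
  then show "past_vertex (history n \<omega>) k = V k \<omega>" "past_friend (history n \<omega>) k = W k \<omega>"
    by (simp_all add: past_vertex_def past_friend_def)
qed

lemma history_eq_iff:
  assumes len: "length h = n - 2"
  shows "history n \<omega> = h \<longleftrightarrow>
    (\<forall>k\<in>{2..<n}. V k \<omega> = past_vertex h k \<and> W k \<omega> = past_friend h k)"
proof
  assume "history n \<omega> = h"
  then show "\<forall>k\<in>{2..<n}. V k \<omega> = past_vertex h k \<and> W k \<omega> = past_friend h k"
    using past_history[of _ n \<omega>] by auto
next
  assume eq: "\<forall>k\<in>{2..<n}. V k \<omega> = past_vertex h k \<and> W k \<omega> = past_friend h k"
  show "history n \<omega> = h"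
  proof (rule nth_equalityI)
    fix i assume "i < length (history n \<omega>)"
    then have i: "i < n - 2" by simp
    then have "V (i + 2) \<omega> = past_vertex h (i + 2) \<and> W (i + 2) \<omega> = past_friend h (i + 2)"
      using eq by auto
    then show "history n \<omega> ! i = h ! i"
      using i by (simp add: history_def past_vertex_def past_friend_def add.commute)
  qed (simp add: len)
qed

lemma sets_V: "n \<ge> 2 \<Longrightarrow> {\<omega> \<in> space M. V n \<omega> = a} \<in> events"
  using measurable_sets[OF measurable_V, of n "{a}"] by (simp add: vimage_def Int_def conj_commute)

lemma sets_W: "n \<ge> 2 \<Longrightarrow> {\<omega> \<in> space M. W n \<omega> = b} \<in> events"
  using measurable_sets[OF measurable_W, of n "{b}"] by (simp add: vimage_def Int_def conj_commute)

lemma sets_history: "{\<omega> \<in> space M. history n \<omega> = h} \<in> events"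
proof (cases "length h = n - 2")
  case True
  show ?thesis unfolding history_eq_iff[OF True]
    by (intro sets.sets_Collect_finite_All sets.sets_Collect_conj sets_V sets_W) auto
next
  case False
  then have "{\<omega> \<in> space M. history n \<omega> = h} = {}" by auto
  then show ?thesis by (simp only: sets.empty_sets)
qed

lemma measurable_history [measurable]: "history n \<in> measurable M (count_space UNIV)"
  unfolding measurable_count_space_eq2_countable
  using sets_history[of n] by (simp add: vimage_def Int_def conj_commute)

text \<open>Where the conditioning events have probability zero the assumptions on the process say nothing, but
  there both sides vanish.\<close>

lemma prob_history_step:
  assumes n: "n \<ge> 2"
  shows "prob {\<omega> \<in> space M. history n \<omega> = h \<and> V n \<omega> = a \<and> W n \<omega> = b}
    = prob {\<omega> \<in> space M. history n \<omega> = h} * pmf (friend_step n h) (a, b)"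
proof (cases "prob {\<omega> \<in> space M. history n \<omega> = h} = 0")
  case True
  have "prob {\<omega> \<in> space M. history n \<omega> = h \<and> V n \<omega> = a \<and> W n \<omega> = b}
      \<le> prob {\<omega> \<in> space M. history n \<omega> = h}"
    by (rule finite_measure_mono[OF _ sets_history]) auto
  then show ?thesis using True measure_le_0_iff by auto
next
  case False
  then have "{\<omega> \<in> space M. history n \<omega> = h} \<noteq> {}" using measure_empty[of M] by metis
  then obtain \<omega> where "history n \<omega> = h" by blast
  then have len: "length h = n - 2" using length_history by metis
  let ?Q = "\<lambda>\<omega>. \<forall>k\<in>{2..<n}. V k \<omega> = past_vertex h k \<and> W k \<omega> = past_friend h k"
  note iff = history_eq_iff[OF len]
  have Q: "\<P>(\<omega> in M. ?Q \<omega>) > 0"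
    using False measure_nonneg[of M] unfolding iff by (simp add: less_le)
  have V: "\<P>(\<omega> in M. ?Q \<omega> \<and> V n \<omega> = a) = \<P>(\<omega> in M. ?Q \<omega>) * pmf (pmf_of_set {1..n}) a"
    using uniform_vertex[OF n Q, of a] Q by (simp add: cond_prob_def field_simps conj_commute)
  have W: "\<P>(\<omega> in M. ?Q \<omega> \<and> V n \<omega> = a \<and> W n \<omega> = b) = \<P>(\<omega> in M. ?Q \<omega> \<and> V n \<omega> = a)
      * pmf (pmf_of_set (neighbours (attach_tree (past_friend h) n) a)) b"
  proof (cases "\<P>(\<omega> in M. ?Q \<omega> \<and> V n \<omega> = a) = 0")
    case True
    have "\<P>(\<omega> in M. ?Q \<omega> \<and> V n \<omega> = a \<and> W n \<omega> = b) \<le> \<P>(\<omega> in M. ?Q \<omega> \<and> V n \<omega> = a)"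
    proof (rule finite_measure_mono)
      show "{\<omega> \<in> space M. ?Q \<omega> \<and> V n \<omega> = a} \<in> events"
        using sets.sets_Collect_conj[OF sets_V[OF n, of a] sets_history[of n h]] unfolding iff .
    qed auto
    then show ?thesis using True measure_le_0_iff by auto
  next
    case False
    then have pos: "\<P>(\<omega> in M. ?Q \<omega> \<and> V n \<omega> = a) > 0"
      using measure_nonneg[of M] by (simp add: less_le)
    have "{\<omega> \<in> space M. W n \<omega> = b \<and> ?Q \<omega> \<and> V n \<omega> = a}
        = {\<omega> \<in> space M. ?Q \<omega> \<and> V n \<omega> = a \<and> W n \<omega> = b}" by blast
    then show ?thesis
      using uniform_neighbour[OF n pos, of b] pos by (simp add: cond_prob_def field_simps)
  qed
  show ?thesis unfolding iff using V W by (simp add: pmf_friend_step)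
qed

lemma prob_history: "prob {\<omega> \<in> space M. history n \<omega> = h} = pmf (history_pmf n) h"
proof (induction n arbitrary: h)
  case 0
  show ?case by (cases "h = []") (auto simp: history_def prob_space)
next
  case (Suc n)
  show ?case
  proof (cases "n < 2")
    case True
    then show ?thesis by (cases "h = []") (auto simp: history_def prob_space)
  next
    case False
    then have n: "n \<ge> 2" by simp
    show ?thesis
    proof (cases h rule: rev_cases)
      case Nil
      have "[] \<notin> set_pmf (history_pmf (Suc n))" using n by auto
      then have "pmf (history_pmf (Suc n)) [] = 0" by (simp only: set_pmf_iff not_not)
      moreover have "{\<omega> \<in> space M. history (Suc n) \<omega> = []} = {}" using history_Suc[OF n] by simp
      ultimately show ?thesis unfolding Nil by (simp only: measure_empty)
    next
      case (snoc h' x)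
      obtain a b where x: "x = (a, b)" by (cases x)
      have "{\<omega> \<in> space M. history (Suc n) \<omega> = h}
          = {\<omega> \<in> space M. history n \<omega> = h' \<and> V n \<omega> = a \<and> W n \<omega> = b}"
        unfolding snoc x using history_Suc[OF n] by auto
      then show ?thesis
        by (simp only: prob_history_step[OF n] pmf_history_Suc[OF n] Suc.IH snoc x)
    qed
  qed
qed

lemma distr_history: "distr M (count_space UNIV) (history n) = measure_pmf (history_pmf n)"
proof (rule measure_eqI_countable[of _ UNIV])
  fix h :: "(nat \<times> nat) list"
  have "history n -` {h} \<inter> space M = {\<omega> \<in> space M. history n \<omega> = h}" by auto
  then show "emeasure (distr M (count_space UNIV) (history n)) {h}
      = emeasure (measure_pmf (history_pmf n)) {h}"
    by (simp add: emeasure_distr emeasure_eq_measure prob_history emeasure_pmf_single)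
qed auto

lemma nn_integral_history:
  "(\<integral>\<^sup>+\<omega>. F (history n \<omega>) \<partial>M) = (\<integral>\<^sup>+h. F h \<partial>history_pmf n)"
  unfolding distr_history[symmetric] by (subst nn_integral_distr) auto

lemma Diam_eq: "Diam W n \<omega> = tree_diameter (\<lambda>k. W k \<omega>) n"
  by (simp add: Diam_def friend_tree_def)

lemma Diam_history: "Diam W n \<omega> = tree_diameter (past_friend (history n \<omega>)) n"
proof -
  have "attach_tree (\<lambda>k. W k \<omega>) n = attach_tree (past_friend (history n \<omega>)) n"
    by (rule attach_tree_cong) (simp add: past_history)
  then show ?thesis unfolding Diam_eq by simp
qed

lemma measurable_Diam [measurable]: "(\<lambda>\<omega>. real (Diam W n \<omega>)) \<in> borel_measurable M"
  unfolding Diam_history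
  by (rule measurable_compose[OF measurable_history, where g = "\<lambda>h. real (tree_diameter (past_friend h) n)"])
     simp

lemma AE_friend_choices: "AE \<omega> in M. \<forall>n. friend_choices (\<lambda>k. V k \<omega>) (\<lambda>k. W k \<omega>) n"
  unfolding AE_all_countable
proof
  fix n
  have "AE h in distr M (count_space UNIV) (history n).
      friend_choices (past_vertex h) (past_friend h) n"
    unfolding distr_history using history_support by (auto simp: AE_measure_pmf_iff)
  then have "AE \<omega> in M. friend_choices (past_vertex (history n \<omega>)) (past_friend (history n \<omega>)) n"
    by (subst (asm) AE_distr_iff) auto
  then show "AE \<omega> in M. friend_choices (\<lambda>k. V k \<omega>) (\<lambda>k. W k \<omega>) n"
  proof eventually_elim
    case (elim \<omega>)
    then show ?case
      using friend_choices_cong[of n "past_vertex (history n \<omega>)" "\<lambda>k. V k \<omega>"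
          "past_friend (history n \<omega>)" "\<lambda>k. W k \<omega>"] by (simp add: past_history)
  qed
qed

lemma AE_Diam_mono: "AE \<omega> in M. \<forall>m n. 2 \<le> m \<longrightarrow> m \<le> n \<longrightarrow> Diam W m \<omega> \<le> Diam W n \<omega>"
  using AE_friend_choices
proof eventually_elim
  case (elim \<omega>)
  show ?case
  proof (intro allI impI)
    fix m n :: nat assume m: "2 \<le> m" and "m \<le> n"
    from this(2) show "Diam W m \<omega> \<le> Diam W n \<omega>"
    proof (induction n rule: dec_induct)
      case (step n)
      have "Diam W n \<omega> \<le> Diam W (Suc n) \<omega>"
        unfolding Diam_eq
        by (rule tree_diameter_mono[OF _ friend_choices_attachment]) (use elim m step.hyps in auto)
      with step.IH show ?case by simp
    qed simp
  qed
qed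

lemma expected_exp_Diam_le:
  assumes "n \<ge> 2"
  shows "(\<integral>\<^sup>+\<omega>. ennreal (exp (real (Diam W n \<omega>) / 4)) \<partial>M)
    \<le> ennreal (2 * exp (1 / 2) * real n powr exp 1)"
proof -
  let ?S = "\<lambda>h. \<Sum>i = 1..n. exp (real (recursive_depth (past_vertex h) i))"
  have "(\<integral>\<^sup>+\<omega>. ennreal (exp (real (Diam W n \<omega>) / 4)) \<partial>M)
      = (\<integral>\<^sup>+h. ennreal (exp (real (tree_diameter (past_friend h) n) / 4)) \<partial>history_pmf n)"
    unfolding Diam_history
    by (rule nn_integral_history[of "\<lambda>h. ennreal (exp (real (tree_diameter (past_friend h) n) / 4))"])
  also have "\<dots> \<le> (\<integral>\<^sup>+h. ennreal (exp (1 / 2)) * ennreal (?S h) \<partial>history_pmf n)"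
  proof (rule nn_integral_mono_AE, unfold AE_measure_pmf_iff, rule ballI)
    fix h assume "h \<in> set_pmf (history_pmf n)"
    then have "exp (real (tree_diameter (past_friend h) n) / 4) \<le> exp (1 / 2) * ?S h"
      by (intro tree_diameter_le_depth_sum[OF assms]) (simp add: history_support)
    then show "ennreal (exp (real (tree_diameter (past_friend h) n) / 4))
        \<le> ennreal (exp (1 / 2)) * ennreal (?S h)"
      by (subst ennreal_mult[symmetric]) (auto intro: ennreal_leI sum_nonneg)
  qed
  also have "\<dots> = ennreal (exp (1 / 2)) * (\<integral>\<^sup>+h. ennreal (?S h) \<partial>history_pmf n)"
    by (rule nn_integral_cmult) simp
  also have "\<dots> \<le> ennreal (exp (1 / 2)) * ennreal (2 * (real n - 1) powr exp 1)"
    by (rule mult_left_mono[OF expected_depth_sum_le[OF assms]]) simp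
  also have "\<dots> = ennreal (2 * exp (1 / 2) * (real n - 1) powr exp 1)"
    by (subst ennreal_mult[symmetric]) auto
  also have "\<dots> \<le> ennreal (2 * exp (1 / 2) * real n powr exp 1)"
    using assms by (intro ennreal_leI mult_left_mono powr_mono2) auto
  finally show ?thesis .
qed

text \<open>Every exponent \<open>b > e\<close> is admissible in the comparison along powers of two and gives the constant
  \<open>4 b\<close>.\<close>

lemma AE_limsup_Diam_le: "AE \<omega> in M. limsup (\<lambda>n. ereal (real (Diam W n \<omega>) / ln (real n))) \<le> ereal (4 * exp 1)"
proof -
  define b where "b m = exp 1 + inverse (real (Suc m))" for m
  have "AE \<omega> in M. \<forall>m. \<forall>\<^sub>F k in sequentially. exp (real (Diam W (2 ^ k) \<omega>) / 4) \<le> (2 ^ k) powr b m"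
    unfolding AE_all_countable
  proof
    fix m
    show "AE \<omega> in M. \<forall>\<^sub>F k in sequentially. exp (real (Diam W (2 ^ k) \<omega>) / 4) \<le> (2 ^ k) powr b m"
      by (rule dyadic_eventually_le[OF _ expected_exp_Diam_le]) (auto simp: b_def)
  qed
  with AE_Diam_mono show ?thesis
  proof eventually_elim
    case (elim \<omega>)
    let ?L = "limsup (\<lambda>n. ereal (real (Diam W n \<omega>) / ln (real n)))"
    have le: "?L \<le> ereal (4 * b m)" for m
    proof (rule limsup_dyadic_le)
      show "\<forall>\<^sub>F k in sequentially. real (Diam W (2 ^ k) \<omega>) \<le> 4 * b m * (real k * ln 2)"
        using elim(2)[rule_format, of m]
      proof eventually_elim
        case (elim k)
        then have "exp (real (Diam W (2 ^ k) \<omega>) / 4) \<le> exp (b m * (real k * ln 2))"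
          by (simp add: powr_def ln_realpow)
        then have "real (Diam W (2 ^ k) \<omega>) / 4 \<le> b m * (real k * ln 2)"
          by (subst (asm) exp_le_cancel_iff)
        then show ?case by simp
      qed
    qed (use elim in \<open>auto simp: b_def add_nonneg_nonneg\<close>)
    have lim: "(\<lambda>m. ereal (4 * b m)) \<longlonglongrightarrow> ereal (4 * exp 1)"
      unfolding b_def
      by (intro tendsto_intros LIMSEQ_inverse_real_of_nat_add)
    show ?case by (rule LIMSEQ_le_const[OF lim]) (use le in blast)
  qed
qed

text \<open>The moment with parameter \<open>t\<close> allows every constant below \<open>(1 - exp (- t)) / t\<close>. The value
  \<open>1 / (1 + t)\<^sup>2\<close> is such a constant, as \<open>exp t \<ge> 1 + t\<close>, and it tends to \<open>1\<close> with \<open>t \<rightarrow> 0\<close>.\<close>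

lemma AE_liminf_Diam_ge: "AE \<omega> in M. 1 \<le> liminf (\<lambda>n. ereal (real (Diam W n \<omega>) / ln (real n)))"
proof -
  define t where "t m = inverse (real (Suc m))" for m
  define c where "c m = 1 / (1 + t m)\<^sup>2" for m
  have t: "t m > 0" for m by (simp add: t_def)
  have "AE \<omega> in M. \<forall>m. \<forall>\<^sub>F k in sequentially.
      exp (- t m * real (Diam W (2 ^ k) \<omega>)) \<le> (2 ^ k) powr (- t m * c m)"
    unfolding AE_all_countable
  proof
    fix m
    have bound: "(\<integral>\<^sup>+\<omega>. ennreal (exp (- t m * real (Diam W n \<omega>))) \<partial>M)
        \<le> ennreal (2 * real n powr (exp (- t m) - 1))" if "n \<ge> 2" for n
      using expected_exp_neg_diameter_le[OF that t]
        nn_integral_history[of "\<lambda>h. ennreal (exp (- t m * real (tree_diameter (past_friend h) n)))" n]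
      unfolding Diam_history by simp
    have "exp (- t m) \<le> 1 / (1 + t m)"
      unfolding exp_minus inverse_eq_divide using t[of m] exp_ge_add_one_self[of "t m"]
      by (intro divide_left_mono) auto
    also have "\<dots> = 1 - t m / (1 + t m)" using t[of m] by (simp add: field_simps)
    also have "t m * (1 / (1 + t m)\<^sup>2) < t m * (1 / (1 + t m))"
    proof (intro mult_strict_left_mono divide_strict_left_mono)
      show "1 + t m < (1 + t m)\<^sup>2"
        using t[of m] mult_strict_left_mono[of 1 "1 + t m" "1 + t m"] by (simp add: power2_eq_square)
    qed (use t[of m] in auto)
    then have "1 - t m / (1 + t m) < 1 - t m * c m" by (simp add: c_def)
    finally have less: "exp (- t m) - 1 < - t m * c m" by simp
    show "AE \<omega> in M. \<forall>\<^sub>F k in sequentially.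
        exp (- t m * real (Diam W (2 ^ k) \<omega>)) \<le> (2 ^ k) powr (- t m * c m)"
      by (rule dyadic_eventually_le[OF _ bound _ less]) auto
  qed
  with AE_Diam_mono show ?thesis
  proof eventually_elim
    case (elim \<omega>)
    let ?L = "liminf (\<lambda>n. ereal (real (Diam W n \<omega>) / ln (real n)))"
    have le: "ereal (c m) \<le> ?L" for m
    proof (rule liminf_dyadic_ge)
      show "\<forall>\<^sub>F k in sequentially. c m * (real k * ln 2) \<le> real (Diam W (2 ^ k) \<omega>)"
        using elim(2)[rule_format, of m]
      proof eventually_elim
        case (elim k)
        then have "exp (- t m * real (Diam W (2 ^ k) \<omega>)) \<le> exp (- t m * c m * (real k * ln 2))"
          by (simp add: powr_def ln_realpow)
        then have "t m * (c m * (real k * ln 2)) \<le> t m * real (Diam W (2 ^ k) \<omega>)"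
          by (subst (asm) exp_le_cancel_iff) (simp add: mult.assoc)
        then show ?case using t[of m] by simp
      qed
    qed (use elim in \<open>auto simp: c_def\<close>)
    have lim: "(\<lambda>m. ereal (c m)) \<longlonglongrightarrow> ereal (1 / (1 + 0)\<^sup>2)"
      unfolding c_def t_def
      by (intro tendsto_intros LIMSEQ_inverse_real_of_nat) auto
    have "ereal (1 / (1 + 0)\<^sup>2) \<le> ?L"
      by (rule LIMSEQ_le_const2[OF lim]) (use le in blast)
    then show ?case by (simp add: one_ereal_def)
  qed
qed

end

theorem theorem4p2:
  fixes M :: "'a measure" and V W :: "nat \<Rightarrow> 'a \<Rightarrow> nat"
  assumes "random_friend_tree M V W"
  shows "AE \<omega> in M.
      1 \<le> liminf (\<lambda>n. ereal (real (Diam W n \<omega>) / ln (real n))) \<and>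
      liminf (\<lambda>n. ereal (real (Diam W n \<omega>) / ln (real n)))
        \<le> limsup (\<lambda>n. ereal (real (Diam W n \<omega>) / ln (real n))) \<and>
      limsup (\<lambda>n. ereal (real (Diam W n \<omega>) / ln (real n))) \<le> ereal (4 * exp 1)"
proof -
  interpret random_friend_tree M V W by (rule assms)
  show ?thesis
    using AE_liminf_Diam_ge AE_limsup_Diam_le
    by eventually_elim (auto intro: Liminf_le_Limsup)
qed

end
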